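(* (Discrete quantum filtering equation for photon counting.) Consider the repeated interaction model described in the context with photodetection observations $\Delta Y(l)=U(l)^*\Delta\Lambda(l)U(l)$, and let $\pi_l(X)=\mathbb{P}(j_l(X)|\mathscr{Y}_l)$ for $X\in\mathscr{M}$, $0\le l\le k$. For $X\in\mathscr{M}$ put $\mathcal{L}(X)=M^{+*}XM^++\lambda^2M^{\circ*}XM^\circ+M^{\circ*}X+XM^\circ$. Then for every $X\in\mathscr{M}$ and $1\le l\le k$, $\Delta\pi_l(X)=\pi_l(X)-\pi_{l-1}(X)$ satisfies (with probability one) $$\Delta\pi_l(X)=\pi_{l-1}(\mathcal{L}(X))\,\Delta t(l)+\bigl(I-\lambda^2\pi_{l-1}(M^{+*}M^+)\bigr)^{-1}\left[\frac{\pi_{l-1}(M^{+*}XM^+)}{\pi_{l-1}(M^{+*}M^+)}-\pi_{l-1}(X+\lambda^2\mathcal{L}(X))\right]\bigl(\Delta Y(l)-\pi_{l-1}(M^{+*}M^+)\,\Delta t(l)\bigr).$$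
   Context: Let $\mathscr{M}=M_2(\mathbb{C})$, $\sigma_-=\begin{pmatrix}0&0\\1&0\end{pmatrix}$, $\sigma_+=\sigma_-^*$, $\Phi=(0,1)^T$, $\phi(X)=\langle\Phi,X\Phi\rangle$. Fix $k\in\mathbb{N}$, $T>0$, $\lambda=\sqrt{T/k}$, a state $\rho$ on $\mathscr{M}$, $\mathscr{W}_k=\mathscr{M}^{\otimes k}$, and the state $\mathbb{P}=\rho\otimes\phi^{\otimes k}$ on $\mathscr{M}\otimes\mathscr{W}_k$. Identify $X\in\mathscr{M}$ with $X\otimes I$. For $X\in\mathscr{M}$, $X_i$ denotes $X$ placed in the $i$-th factor of $\mathscr{W}_k$ (identity elsewhere). Set $\Delta A(i)=\lambda(\sigma_-)_i$, $\Delta A^*(i)=\lambda(\sigma_+)_i$, $\Delta\Lambda(i)=(\sigma_+\sigma_-)_i$, $\Delta t(i)=\lambda^2I$. Repeated interaction: given $L_1,L_2,L_3\in\mathscr{M}$ with $L_1,L_3$ self-adjoint, let $M_l=\exp(-i\{L_1\Delta\Lambda(l)+L_2\Delta A^*(l)+L_2^*\Delta A(l)+L_3\Delta t(l)\})$, and let $M^{\pm},M^+,M^-,M^\circ\in\mathscr{M}$ be the unique matrices (independent of $l$) with $M_l-I=M^\pm\Delta\Lambda(l)+M^+\Delta A^*(l)+M^-\Delta A(l)+M^\circ\Delta t(l)$. Put $U(0)=I$, $U(l)=M_lM_{l-1}\cdots M_1$, $j_l(X)=U(l)^*XU(l)$. $\mathscr{Y}_l$ is the $^*$-algebra generated by $I,\Delta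 Y(1),\ldots,\Delta Y(l)$ (so $\mathscr{Y}_0=\mathbb{C}I$); it is commutative and $j_l(X)$ commutes with $\mathscr{Y}_l$ for all $X\in\mathscr{M}$. Conditional expectation: for a commutative $^*$-subalgebra $\mathscr{C}$ with commutant $\mathscr{C}'$ and $B\in\mathscr{C}'$, a version of $\mathbb{P}(B|\mathscr{C})$ is any element of $\mathscr{C}$ with $\mathbb{P}(\mathbb{P}(B|\mathscr{C})C)=\mathbb{P}(BC)$ for all $C\in\mathscr{C}$. Equality "with probability one" of $P,Q\in\mathscr{C}$ means $\mathbb{P}((P-Q)^*(P-Q))=0$. Elements of the commutative algebra $\mathscr{Y}_k$ are identified with complex functions on a finite probability space, so quotients and inverses are understood pointwise. *)

theory Defs
  imports "Jordan_Normal_Form.Schur_Decomposition"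
begin

(* Operators on C^2 (x) (C^2)^(x)k are complex matrices of dimension 2^(k+1); the initial
   system is tensor factor 0, and the i-th factor of the field algebra is factor i, 1 <= i <= k.
   Basis index 0 is the excited state (1,0)^T, index 1 is Phi = (0,1)^T. *)

definition kron :: "complex mat \<Rightarrow> complex mat \<Rightarrow> complex mat" where
  "kron A B = mat (dim_row A * dim_row B) (dim_col A * dim_col B)
     (\<lambda>(i, j). A $$ (i div dim_row B, j div dim_col B) * B $$ (i mod dim_row B, j mod dim_col B))"

abbreviation qdim :: "nat \<Rightarrow> nat" where
  "qdim k \<equiv> 2 ^ Suc k"

definition ampl :: "nat \<Rightarrow> nat \<Rightarrow> complex mat \<Rightarrow> complex mat" where
  "ampl k i X = kron (kron (1\<^sub>m (2 ^ i)) X) (1\<^sub>m (2 ^ (k - i)))"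

definition mat_exp :: "complex mat \<Rightarrow> complex mat" where
  "mat_exp A = mat (dim_row A) (dim_col A) (\<lambda>(i, j). \<Sum>m. (A ^\<^sub>m m) $$ (i, j) / fact m)"

definition is_state :: "nat \<Rightarrow> (complex mat \<Rightarrow> complex) \<Rightarrow> bool" where
  "is_state n f \<longleftrightarrow>
     (\<forall>A \<in> carrier_mat n n. \<forall>B \<in> carrier_mat n n. f (A + B) = f A + f B) \<and>
     (\<forall>c. \<forall>A \<in> carrier_mat n n. f (c \<cdot>\<^sub>m A) = c * f A) \<and>
     f (1\<^sub>m n) = 1 \<and>
     (\<forall>A \<in> carrier_mat n n. Im (f (mat_adjoint A * A)) = 0 \<and> 0 \<le> Re (f (mat_adjoint A * A)))"

(* For linear functionals f on m x m and g on n x n matrices this is f \<circ> (id (x) g), the linear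
   functional with kron A B \<mapsto> f A * g B: g is applied to each n x n block. *)
definition tensor_functional ::
  "nat \<Rightarrow> nat \<Rightarrow> (complex mat \<Rightarrow> complex) \<Rightarrow> (complex mat \<Rightarrow> complex) \<Rightarrow> complex mat \<Rightarrow> complex" where
  "tensor_functional m n f g A =
     f (mat m m (\<lambda>(i, j). g (mat n n (\<lambda>(p, q). A $$ (i * n + p, j * n + q)))))"

definition Phi :: "complex vec" where
  "Phi = vec_of_list [0, 1]"

definition vacuum :: "complex mat \<Rightarrow> complex" where
  "vacuum X = (X *\<^sub>v Phi) \<bullet>c Phi"

fun vacuum_pow :: "nat \<Rightarrow> complex mat \<Rightarrow> complex" where
  "vacuum_pow 0 A = A $$ (0, 0)"
| "vacuum_pow (Suc k) A = tensor_functional 2 (2 ^ k) vacuum (vacuum_pow k) A"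

definition PP :: "(complex mat \<Rightarrow> complex) \<Rightarrow> nat \<Rightarrow> complex mat \<Rightarrow> complex" where
  "PP \<rho> k = tensor_functional 2 (2 ^ k) \<rho> (vacuum_pow k)"


definition sigma_minus :: "complex mat" where
  "sigma_minus = mat_of_rows_list 2 [[0, 0], [1, 0]]"

definition sigma_plus :: "complex mat" where
  "sigma_plus = mat_adjoint sigma_minus"

definition lam :: "nat \<Rightarrow> real \<Rightarrow> complex" where
  "lam k T = complex_of_real (sqrt (T / real k))"

definition dA :: "nat \<Rightarrow> real \<Rightarrow> nat \<Rightarrow> complex mat" where
  "dA k T i = lam k T \<cdot>\<^sub>m ampl k i sigma_minus"

definition dAs :: "nat \<Rightarrow> real \<Rightarrow> nat \<Rightarrow> complex mat" where
  "dAs k T i = lam k T \<cdot>\<^sub>m ampl k i sigma_plus"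

definition dLambda :: "nat \<Rightarrow> nat \<Rightarrow> complex mat" where
  "dLambda k i = ampl k i (sigma_plus * sigma_minus)"

definition dt :: "nat \<Rightarrow> real \<Rightarrow> nat \<Rightarrow> complex mat" where
  "dt k T i = (lam k T)\<^sup>2 \<cdot>\<^sub>m 1\<^sub>m (qdim k)"

definition interaction ::
  "nat \<Rightarrow> real \<Rightarrow> complex mat \<Rightarrow> complex mat \<Rightarrow> complex mat \<Rightarrow> nat \<Rightarrow> complex mat" where
  "interaction k T L1 L2 L3 l = mat_exp ((- \<i>) \<cdot>\<^sub>m
     (ampl k 0 L1 * dLambda k l + ampl k 0 L2 * dAs k T l
      + ampl k 0 (mat_adjoint L2) * dA k T l + ampl k 0 L3 * dt k T l))"

fun evol ::
  "nat \<Rightarrow> real \<Rightarrow> complex mat \<Rightarrow> complex mat \<Rightarrow> complex mat \<Rightarrow> nat \<Rightarrow> complex mat" where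
  "evol k T L1 L2 L3 0 = 1\<^sub>m (qdim k)"
| "evol k T L1 L2 L3 (Suc l) = interaction k T L1 L2 L3 (Suc l) * evol k T L1 L2 L3 l"

definition flow ::
  "nat \<Rightarrow> real \<Rightarrow> complex mat \<Rightarrow> complex mat \<Rightarrow> complex mat \<Rightarrow> nat \<Rightarrow> complex mat \<Rightarrow> complex mat" where
  "flow k T L1 L2 L3 l X =
     mat_adjoint (evol k T L1 L2 L3 l) * ampl k 0 X * evol k T L1 L2 L3 l"

definition dY ::
  "nat \<Rightarrow> real \<Rightarrow> complex mat \<Rightarrow> complex mat \<Rightarrow> complex mat \<Rightarrow> nat \<Rightarrow> complex mat" where
  "dY k T L1 L2 L3 l =
     mat_adjoint (evol k T L1 L2 L3 l) * dLambda k l * evol k T L1 L2 L3 l"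

definition generator :: "complex \<Rightarrow> complex mat \<Rightarrow> complex mat \<Rightarrow> complex mat \<Rightarrow> complex mat" where
  "generator lm Mp Mo X = mat_adjoint Mp * X * Mp + lm\<^sup>2 \<cdot>\<^sub>m (mat_adjoint Mo * X * Mo)
     + mat_adjoint Mo * X + X * Mo"


inductive_set star_algebra :: "nat \<Rightarrow> complex mat set \<Rightarrow> complex mat set"
  for n :: nat and S :: "complex mat set" where
  one: "1\<^sub>m n \<in> star_algebra n S"
| gen: "A \<in> S \<Longrightarrow> A \<in> star_algebra n S"
| add: "A \<in> star_algebra n S \<Longrightarrow> B \<in> star_algebra n S \<Longrightarrow> A + B \<in> star_algebra n S"
| smult: "A \<in> star_algebra n S \<Longrightarrow> c \<cdot>\<^sub>m A \<in> star_algebra n S"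
| mult: "A \<in> star_algebra n S \<Longrightarrow> B \<in> star_algebra n S \<Longrightarrow> A * B \<in> star_algebra n S"
| adjoint: "A \<in> star_algebra n S \<Longrightarrow> mat_adjoint A \<in> star_algebra n S"

definition obs_algebra ::
  "nat \<Rightarrow> real \<Rightarrow> complex mat \<Rightarrow> complex mat \<Rightarrow> complex mat \<Rightarrow> nat \<Rightarrow> complex mat set" where
  "obs_algebra k T L1 L2 L3 l = star_algebra (qdim k) (dY k T L1 L2 L3 ` {1..l})"

definition is_cond_exp ::
  "(complex mat \<Rightarrow> complex) \<Rightarrow> complex mat set \<Rightarrow> complex mat \<Rightarrow> complex mat \<Rightarrow> bool" where
  "is_cond_exp P \<C> B E \<longleftrightarrow> E \<in> \<C> \<and> (\<forall>C \<in> \<C>. P (E * C) = P (B * C))"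

definition eq_as :: "(complex mat \<Rightarrow> complex) \<Rightarrow> complex mat \<Rightarrow> complex mat \<Rightarrow> bool" where
  "eq_as P A B \<longleftrightarrow> P (mat_adjoint (A - B) * (A - B)) = 0"

(* The points of the finite probability space underlying a commutative star-algebra are its
   characters; A is identified with the function \<chi> \<mapsto> \<chi> A. *)
definition is_character :: "nat \<Rightarrow> complex mat set \<Rightarrow> (complex mat \<Rightarrow> complex) \<Rightarrow> bool" where
  "is_character n \<C> \<chi> \<longleftrightarrow> \<chi> (1\<^sub>m n) = 1 \<and>
     (\<forall>A \<in> \<C>. \<forall>B \<in> \<C>. \<chi> (A + B) = \<chi> A + \<chi> B \<and> \<chi> (A * B) = \<chi> A * \<chi> B) \<and>
     (\<forall>c. \<forall>A \<in> \<C>. \<chi> (c \<cdot>\<^sub>m A) = c * \<chi> A) \<and>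
     (\<forall>A \<in> \<C>. \<chi> (mat_adjoint A) = cnj (\<chi> A))"

(* Q is a version of the pointwise quotient A / B; its value is arbitrary wherever B vanishes. *)
definition is_quotient ::
  "nat \<Rightarrow> complex mat set \<Rightarrow> complex mat \<Rightarrow> complex mat \<Rightarrow> complex mat \<Rightarrow> bool" where
  "is_quotient n \<C> A B Q \<longleftrightarrow> Q \<in> \<C> \<and>
     (\<forall>\<chi>. is_character n \<C> \<chi> \<longrightarrow> \<chi> B \<noteq> 0 \<longrightarrow> \<chi> Q = \<chi> A / \<chi> B)"

end

(* Let V embed the initial system as v |-> v (x) Phi (x) ... (x) Phi, so that P(A) = rho(V* A V).
   Conjugation by U(k) turns the observation algebra into an algebra of diagonal matrices, i.e. of
   functions of the record of bits at the sites 1, ..., k.  For a fixed record, let F_l project onto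
   its first l bits and put W_l = F_l U(l) V.  Then mu_l(X) = rho(W_l* X W_l) is the unnormalised
   conditional expectation, and pi_l(X) = mu_l(X) / mu_l(1) at every record of positive probability.
   Since the l-th field factor starts in the vacuum, one interaction gives
     W_l = lambda M+ sigma+ W_{l-1}       if a photon is counted,
     W_l = (1 + lambda^2 M0) W_{l-1}      otherwise,
   which is a linear recursion for mu_l; dividing by mu_l(1) yields the filtering equation pointwise.
   Where a denominator vanishes one of the two outcomes has conditional probability zero, and by
   Cauchy-Schwarz the corresponding numerator vanishes too. *)

theory Submission
  imports Defs
begin

subsection \<open>Adjoints and products\<close>

text \<open>The statement quantifies over arbitrary versions: \<open>\<pi>\<close> is determined
  only up to records of probability zero, and \<open>Q\<close>, \<open>R\<close> are free wherever
  their denominators vanish. So no closed formula for these matrices is derived; each is written as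
  \<open>Psi f\<close>, and f is compared only at basis indices i of nonzero mass
  \<open>wt i\<close>, which is all that \<open>eq_as\<close> sees. Two difficulties shape the rest.
  The observations are rotated by U(k), whereas the filter at time l speaks of U(l); unitarity and
  locality of the interactions reconcile the two, and unitarity is the reason for studying the
  exponential. The initial state is an arbitrary state on 2 x 2 matrices, possibly mixed or not
  faithful, so state vectors become matrices with two columns and squared norms become values of
  \<open>\<rho>\<close> on Gram matrices. Unitarity also yields conservation of mass between the two
  outcomes. It identifies the matrix to be inverted in the equation with the conditional probability
  of no count, which vanishes exactly when a count is certain.\<close>

lemma dim_mat_adjoint [simp]:
  "dim_row (mat_adjoint A) = dim_col A" "dim_col (mat_adjoint A) = dim_row A"
  by (auto simp: mat_adjoint_def)

lemma index_mat_adjoint [simp]: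
  "i < dim_col A \<Longrightarrow> j < dim_row A \<Longrightarrow> mat_adjoint A $$ (i, j) = conjugate (A $$ (j, i))"
  by (auto simp: mat_adjoint_def mat_of_rows_def)

lemma mat_adjoint_carrier [simp]:
  "A \<in> carrier_mat n m \<Longrightarrow> mat_adjoint A \<in> carrier_mat m n"
  by auto

lemma mult_carrier_iff [simp]:
  "A * B \<in> carrier_mat n m \<longleftrightarrow> dim_row A = n \<and> dim_col B = m"
  by auto

lemma mat_adjoint_adjoint [simp]:
  fixes A :: "complex mat" shows "mat_adjoint (mat_adjoint A) = A"
  by (rule eq_matI) auto

lemma mat_adjoint_mult:
  fixes A B :: "complex mat"
  assumes "dim_col A = dim_row B"
  shows "mat_adjoint (A * B) = mat_adjoint B * mat_adjoint A"
  using assms by (intro eq_matI) (auto simp: scalar_prod_def mult.commute)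

lemma mat_adjoint_add:
  fixes A B :: "complex mat"
  assumes "A \<in> carrier_mat n m" "B \<in> carrier_mat n m"
  shows "mat_adjoint (A + B) = mat_adjoint A + mat_adjoint B"
  using assms by (intro eq_matI) auto

lemma mat_adjoint_smult:
  fixes A :: "complex mat" shows "mat_adjoint (c \<cdot>\<^sub>m A) = cnj c \<cdot>\<^sub>m mat_adjoint A"
  by (intro eq_matI) auto

lemma mat_adjoint_one [simp]: "mat_adjoint (1\<^sub>m n :: complex mat) = 1\<^sub>m n"
  by (intro eq_matI) auto

lemma mat_assoc:
  fixes A B C :: "complex mat"
  assumes "dim_col A = dim_row B" "dim_col B = dim_row C"
  shows "(A * B) * C = A * (B * C)"
  using assms by (intro assoc_mult_mat) auto

lemma mat_entry_mult:
  fixes A B :: "complex mat"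
  assumes "i < dim_row A" "j < dim_col B" "dim_col A = n" "dim_row B = n"
  shows "(A * B) $$ (i, j) = (\<Sum>p<n. A $$ (i, p) * B $$ (p, j))"
  using assms by (auto simp: scalar_prod_def atLeast0LessThan)

lemma mult_mat_one [simp]:
  fixes A :: "complex mat"
  shows "dim_row A = n \<Longrightarrow> 1\<^sub>m n * A = A" "dim_col A = n \<Longrightarrow> A * 1\<^sub>m n = A"
  by auto

subsection \<open>The matrix exponential\<close>

lemma pow_mat_carrier:
  "A \<in> carrier_mat n n \<Longrightarrow> A ^\<^sub>m m \<in> carrier_mat n n"
  by (induction m) auto

lemma pow_mat_add:
  fixes A :: "complex mat" assumes "A \<in> carrier_mat n n"
  shows "A ^\<^sub>m (p + q) = A ^\<^sub>m p * A ^\<^sub>m q"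
proof (induction q)
  case 0
  then show ?case using pow_mat_carrier[OF assms, of p] assms by simp
next
  case (Suc q)
  then show ?case
    using pow_mat_carrier[OF assms, of p] pow_mat_carrier[OF assms, of q] assms
    by (simp add: mat_assoc)
qed

lemma pow_mat_smult:
  fixes A :: "complex mat" assumes "A \<in> carrier_mat n n"
  shows "(c \<cdot>\<^sub>m A) ^\<^sub>m p = c ^ p \<cdot>\<^sub>m A ^\<^sub>m p"
proof (induction p)
  case 0
  then show ?case by (intro eq_matI) auto
next
  case (Suc q)
  then show ?case
    using pow_mat_carrier[OF assms, of q] assms
    by (intro eq_matI) (auto simp: mult_ac)
qed

lemma mat_adjoint_pow:
  fixes A :: "complex mat" assumes "A \<in> carrier_mat n n"
  shows "mat_adjoint (A ^\<^sub>m p) = mat_adjoint A ^\<^sub>m p"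
proof (induction p)
  case 0
  then show ?case using assms by auto
next
  case (Suc q)
  have "A ^\<^sub>m Suc q = A * A ^\<^sub>m q" using pow_mat_add[OF assms, of 1 q] assms by simp
  then have "mat_adjoint (A ^\<^sub>m Suc q) = mat_adjoint (A ^\<^sub>m q) * mat_adjoint A"
    using pow_mat_carrier[OF assms, of q] assms by (simp add: mat_adjoint_mult)
  then show ?case by (simp add: Suc)
qed

text \<open>The sum of the norms of all entries dominates every column sum, so each further factor
  \<open>A\<close> costs at most one factor of it. Comparison with the scalar exponential series
  then gives absolute convergence entry by entry.\<close>

lemma pow_mat_entry_bound:
  fixes A :: "complex mat" assumes "A \<in> carrier_mat n n" "i < n" "j < n"
  shows "norm ((A ^\<^sub>m p) $$ (i, j)) \<le> (\<Sum>r<n. \<Sum>s<n. norm (A $$ (r, s))) ^ p"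
  using assms(3)
proof (induction p arbitrary: j)
  case 0
  then show ?case using assms by (auto simp: one_mat_def)
next
  case (Suc p)
  let ?c = "\<Sum>r<n. \<Sum>s<n. norm (A $$ (r, s))"
  have c: "0 \<le> ?c" by (intro sum_nonneg) auto
  have "norm ((A ^\<^sub>m Suc p) $$ (i, j)) = norm (\<Sum>r<n. (A ^\<^sub>m p) $$ (i, r) * A $$ (r, j))"
    using assms Suc(2) pow_mat_carrier[OF assms(1), of p]
    by (simp add: mat_entry_mult[where n = n] del: index_mult_mat)
  also have "\<dots> \<le> (\<Sum>r<n. ?c ^ p * norm (A $$ (r, j)))"
    using Suc c by (intro sum_norm_le) (auto simp: norm_mult intro!: mult_right_mono)
  also have "\<dots> = ?c ^ p * (\<Sum>r<n. norm (A $$ (r, j)))"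
    by (simp add: sum_distrib_left)
  also have "\<dots> \<le> ?c ^ p * ?c"
    using Suc(2) c by (intro mult_left_mono sum_mono member_le_sum) auto
  finally show ?case by (simp add: mult.commute)
qed

lemma summable_mat_exp:
  fixes A :: "complex mat" assumes "A \<in> carrier_mat n n" "i < n" "j < n"
  shows "summable (\<lambda>p. norm ((A ^\<^sub>m p) $$ (i, j) / fact p))"
proof -
  let ?c = "\<Sum>r<n. \<Sum>s<n. norm (A $$ (r, s))"
  have "summable (\<lambda>p. ?c ^ p / fact p)"
    using summable_exp_generic[of ?c] by (simp add: scaleR_conv_of_real field_simps)
  then show ?thesis
    by (rule summable_comparison_test[rotated])
      (use pow_mat_entry_bound[OF assms] in \<open>auto simp: norm_divide intro!: divide_right_mono\<close>)
qed

lemma mat_exp_carrier [simp]: "A \<in> carrier_mat n n \<Longrightarrow> mat_exp A \<in> carrier_mat n n"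
  by (auto simp: mat_exp_def)

lemma mat_adjoint_exp:
  assumes "A \<in> carrier_mat n n"
  shows "mat_adjoint (mat_exp A) = mat_exp (mat_adjoint A)"
proof (rule eq_matI)
  fix i j assume "i < dim_row (mat_exp (mat_adjoint A))" "j < dim_col (mat_exp (mat_adjoint A))"
  then have ij: "i < n" "j < n" using assms by (auto simp: mat_exp_def)
  have s: "summable (\<lambda>p. (A ^\<^sub>m p) $$ (j, i) / fact p)"
    using summable_norm_cancel[OF summable_mat_exp[OF assms ij(2,1)]] .
  have *: "(mat_adjoint A ^\<^sub>m p) $$ (i, j) = cnj ((A ^\<^sub>m p) $$ (j, i))" for p
    using ij assms pow_mat_carrier[OF assms, of p]
    by (subst mat_adjoint_pow[OF assms, symmetric]) auto
  have "cnj (\<Sum>p. (A ^\<^sub>m p) $$ (j, i) / fact p) = (\<Sum>p. cnj ((A ^\<^sub>m p) $$ (j, i) / fact p))"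
    using summable_sums[OF s] by (metis sums_cnj sums_unique)
  then show "mat_adjoint (mat_exp A) $$ (i, j) = mat_exp (mat_adjoint A) $$ (i, j)"
    using ij assms by (simp add: mat_exp_def *)
qed (use assms in \<open>auto simp: mat_exp_def\<close>)

text \<open>This is (1 + (-1))^t divided by t!, the coefficient of degree t in the product of the
  series for exp(A) and exp(-A).\<close>

lemma alternating_fact_sum:
  "(\<Sum>q\<le>t. (-1) ^ (t - q) / (fact q * fact (t - q))) = (if t = 0 then 1 else 0 :: complex)"
proof -
  have "(\<Sum>q\<le>t. (-1) ^ (t - q) / (fact q * fact (t - q))) * fact t
      = (\<Sum>q\<le>t. of_nat (t choose q) * 1 ^ q * (-1 :: complex) ^ (t - q))"
    unfolding sum_distrib_right
    by (intro sum.cong) (auto simp: binomial_fact)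
  also have "\<dots> = (1 + (-1)) ^ t" by (rule binomial_ring[symmetric])
  finally show ?thesis by (cases "t = 0") (auto simp del: sum.atMost_Suc simp: power_0_left)
qed

text \<open>Entrywise Cauchy products: powers of \<open>A\<close> multiply to A^t in every term of
  degree t, so only the scalar coefficient survives, and it vanishes for t > 0.\<close>

lemma mat_exp_inverse:
  assumes A: "A \<in> carrier_mat n n"
  shows "mat_exp A * mat_exp ((-1) \<cdot>\<^sub>m A) = 1\<^sub>m n"
proof (rule eq_matI)
  fix i j assume "i < dim_row (1\<^sub>m n :: complex mat)" "j < dim_col (1\<^sub>m n :: complex mat)"
  then have ij: "i < n" "j < n" by auto
  have nA: "(-1) \<cdot>\<^sub>m A \<in> carrier_mat n n" using A by auto
  define a where "a p q r = (A ^\<^sub>m p) $$ (q, r)" for p q r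
  define b where "b p q r = (((-1) \<cdot>\<^sub>m A) ^\<^sub>m p) $$ (q, r)" for p q r
  have b: "b p q r = (-1) ^ p * a p q r" if "q < n" "r < n" for p q r
    using that A by (simp add: a_def b_def pow_mat_smult[OF A])
  have aa: "(\<Sum>r<n. a p i r * a q r j) = a (p + q) i j" for p q
    using ij A pow_mat_carrier[OF A, of p] pow_mat_carrier[OF A, of q]
    by (simp add: a_def pow_mat_add[OF A] mat_entry_mult[where n = n] del: index_mult_mat)
  have sa: "summable (\<lambda>p. norm (a p q r / fact p))" if "q < n" "r < n" for q r
    using summable_mat_exp[OF A that] by (simp add: a_def)
  have sb: "summable (\<lambda>p. norm (b p q r / fact p))" if "q < n" "r < n" for q r
    using summable_mat_exp[OF nA that] by (simp add: b_def)
  have "(mat_exp A * mat_exp ((-1) \<cdot>\<^sub>m A)) $$ (i, j)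
      = (\<Sum>r<n. (\<Sum>p. a p i r / fact p) * (\<Sum>p. b p r j / fact p))"
    using ij A
    by (subst mat_entry_mult[where n = n])
      (auto simp: mat_exp_def a_def b_def intro!: sum.cong)
  also have "\<dots> = (\<Sum>r<n. \<Sum>t. \<Sum>p\<le>t. (a p i r / fact p) * (b (t - p) r j / fact (t - p)))"
    using ij sa sb by (intro sum.cong refl Cauchy_product) auto
  also have "\<dots> = (\<Sum>t. \<Sum>r<n. \<Sum>p\<le>t. (a p i r / fact p) * (b (t - p) r j / fact (t - p)))"
    using ij sa sb by (intro suminf_sum[symmetric] summable_Cauchy_product) auto
  also have "\<dots> = (\<Sum>t. if t = 0 then a 0 i j else 0)"
  proof (rule suminf_cong)
    fix t
    have "(\<Sum>r<n. \<Sum>p\<le>t. (a p i r / fact p) * (b (t - p) r j / fact (t - p)))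
        = (\<Sum>p\<le>t. \<Sum>r<n. (-1) ^ (t - p) / (fact p * fact (t - p)) * (a p i r * a (t - p) r j))"
      using ij by (subst sum.swap) (auto simp: b intro!: sum.cong)
    also have "\<dots> = (\<Sum>p\<le>t. (-1) ^ (t - p) / (fact p * fact (t - p)) * a t i j)"
      by (intro sum.cong) (simp_all only: sum_distrib_left[symmetric] aa atMost_iff le_add_diff_inverse)
    also have "\<dots> = (if t = 0 then a 0 i j else 0)"
      by (simp only: sum_distrib_right[symmetric] alternating_fact_sum) simp
    finally show "(\<Sum>r<n. \<Sum>p\<le>t. (a p i r / fact p) * (b (t - p) r j / fact (t - p)))
        = (if t = 0 then a 0 i j else 0)" .
  qed
  also have "\<dots> = a 0 i j"
    using suminf_finite[of "{0::nat}" "\<lambda>t. if t = 0 then a 0 i j else 0"] by simp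
  finally show "(mat_exp A * mat_exp ((-1) \<cdot>\<^sub>m A)) $$ (i, j) = 1\<^sub>m n $$ (i, j)"
    using A by (simp add: a_def)
qed (use A in \<open>auto simp: mat_exp_def\<close>)

lemma mat_exp_skew_unitary:
  assumes "A \<in> carrier_mat n n" "mat_adjoint A = (-1) \<cdot>\<^sub>m A"
  shows "mat_exp A * mat_adjoint (mat_exp A) = 1\<^sub>m n" "mat_adjoint (mat_exp A) * mat_exp A = 1\<^sub>m n"
proof -
  show *: "mat_exp A * mat_adjoint (mat_exp A) = 1\<^sub>m n"
    using mat_exp_inverse[OF assms(1)] assms by (simp add: mat_adjoint_exp)
  show "mat_adjoint (mat_exp A) * mat_exp A = 1\<^sub>m n"
    using mat_mult_left_right_inverse[OF _ _ *] assms(1) by simp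
qed

subsection \<open>Kronecker products\<close>

lemma div_less_mult: "i < a * b \<Longrightarrow> i div b < a" for i a b :: nat
  by (simp add: less_mult_imp_div_less)

lemma mod_less_mult: "i < a * b \<Longrightarrow> i mod b < b" for i a b :: nat
  by (cases b) auto

text \<open>Matches the pairing of indices in \<open>kron\<close>, so that a product of Kronecker
  products factors into two sums.\<close>

lemma sum_div_mod:
  fixes f :: "nat \<Rightarrow> nat \<Rightarrow> 'a :: comm_monoid_add"
  shows "(\<Sum>r<n * m. f (r div m) (r mod m)) = (\<Sum>a<n. \<Sum>b<m. f a b)"
proof -
  have "(\<Sum>a<n. \<Sum>b<m. f a b) = (\<Sum>a<n. \<Sum>r\<in>{a * m..<a * m + m}. f (r div m) (r mod m))"
  proof (rule sum.cong[OF refl])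
    fix a
    have "(\<Sum>r\<in>{a * m..<a * m + m}. f (r div m) (r mod m))
        = (\<Sum>b\<in>{0..<m}. f ((b + a * m) div m) ((b + a * m) mod m))"
      using sum.shift_bounds_nat_ivl[of "\<lambda>r. f (r div m) (r mod m)" 0 "a * m" m]
      by (simp add: add.commute)
    also have "\<dots> = (\<Sum>b<m. f a b)"
      by (auto simp: atLeast0LessThan intro!: sum.cong)
    finally show "(\<Sum>b<m. f a b) = (\<Sum>r\<in>{a * m..<a * m + m}. f (r div m) (r mod m))" ..
  qed
  then show ?thesis by (simp add: sum.nat_group)
qed

lemma dim_kron [simp]:
  "dim_row (kron A B) = dim_row A * dim_row B" "dim_col (kron A B) = dim_col A * dim_col B"
  by (auto simp: kron_def)

lemma index_kron:
  "i < dim_row A * dim_row B \<Longrightarrow> j < dim_col A * dim_col B \<Longrightarrow>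
   kron A B $$ (i, j) = A $$ (i div dim_row B, j div dim_col B) * B $$ (i mod dim_row B, j mod dim_col B)"
  by (auto simp: kron_def)

lemma kron_mult:
  assumes "dim_col A = dim_row C" "dim_col B = dim_row D"
  shows "kron A B * kron C D = kron (A * C) (B * D)"
proof (rule eq_matI)
  fix i j assume "i < dim_row (kron (A * C) (B * D))" "j < dim_col (kron (A * C) (B * D))"
  then have ij: "i < dim_row A * dim_row B" "j < dim_col C * dim_col D" by auto
  note b = div_less_mult[OF ij(1)] div_less_mult[OF ij(2)] mod_less_mult[OF ij(1)] mod_less_mult[OF ij(2)]
  let ?n = "dim_row C" and ?m = "dim_row D"
  have "(kron A B * kron C D) $$ (i, j)
     = (\<Sum>r<?n * ?m. (A $$ (i div dim_row B, r div ?m) * B $$ (i mod dim_row B, r mod ?m))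
        * (C $$ (r div ?m, j div dim_col D) * D $$ (r mod ?m, j mod dim_col D)))"
    using ij assms by (subst mat_entry_mult[where n = "?n * ?m"]) (auto simp: index_kron)
  also have "\<dots> = (\<Sum>p<?n. \<Sum>q<?m. (A $$ (i div dim_row B, p) * B $$ (i mod dim_row B, q))
        * (C $$ (p, j div dim_col D) * D $$ (q, j mod dim_col D)))"
    by (rule sum_div_mod)
  also have "\<dots> = (A * C) $$ (i div dim_row B, j div dim_col D) * (B * D) $$ (i mod dim_row B, j mod dim_col D)"
    using b assms
    by (simp add: mat_entry_mult[where n = "?n"] mat_entry_mult[where n = "?m"] sum_product mult_ac
        del: index_mult_mat)
  finally show "(kron A B * kron C D) $$ (i, j) = kron (A * C) (B * D) $$ (i, j)"
    using ij by (simp add: index_kron del: index_mult_mat(1))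
qed (use assms in auto)

lemma kron_assoc: "kron (kron A B) C = kron A (kron B C)"
proof (rule eq_matI)
  fix i j assume "i < dim_row (kron A (kron B C))" "j < dim_col (kron A (kron B C))"
  then have i: "i < dim_row A * dim_row B * dim_row C" and j: "j < dim_col A * dim_col B * dim_col C"
    by (auto simp: mult.assoc)
  have h: "x mod (b * c) div c = x div c mod b \<and> x mod (b * c) mod c = x mod c \<and>
      x div c div b = x div (b * c) \<and> x div c < a * b \<and> x mod (b * c) < b * c"
    if "x < a * b * c" for x a b c :: nat
  proof -
    have "c > 0" "b > 0" using that by (auto intro: gr0I)
    moreover from this have "x mod (b * c) < b * c" by simp
    ultimately show ?thesis using that
      by (auto simp: mod_mult2_eq mult.commute[of b c] div_mult2_eq less_mult_imp_div_less)
  qed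
  show "kron (kron A B) C $$ (i, j) = kron A (kron B C) $$ (i, j)"
    using i j h[OF i] h[OF j] by (simp add: index_kron mult.assoc[symmetric])
qed (auto simp: mult.assoc)

lemma kron_one: "kron (1\<^sub>m a) (1\<^sub>m b) = 1\<^sub>m (a * b)"
proof (rule eq_matI)
  fix i j assume "i < dim_row (1\<^sub>m (a * b) :: complex mat)" "j < dim_col (1\<^sub>m (a * b) :: complex mat)"
  then have ij: "i < a * b" "j < a * b" by auto
  have "i = j \<longleftrightarrow> i div b = j div b \<and> i mod b = j mod b" by (metis div_mult_mod_eq)
  then show "kron (1\<^sub>m a) (1\<^sub>m b) $$ (i, j) = 1\<^sub>m (a * b) $$ (i, j)"
    using ij div_less_mult[OF ij(1)] div_less_mult[OF ij(2)] mod_less_mult[OF ij(1)] mod_less_mult[OF ij(2)]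
    by (auto simp: index_kron)
qed auto

lemma kron_adjoint: "mat_adjoint (kron A B) = kron (mat_adjoint A) (mat_adjoint B)"
proof (rule eq_matI)
  fix i j assume "i < dim_row (kron (mat_adjoint A) (mat_adjoint B))"
    "j < dim_col (kron (mat_adjoint A) (mat_adjoint B))"
  then have ij: "i < dim_col A * dim_col B" "j < dim_row A * dim_row B" by auto
  then show "mat_adjoint (kron A B) $$ (i, j) = kron (mat_adjoint A) (mat_adjoint B) $$ (i, j)"
    using div_less_mult[OF ij(1)] div_less_mult[OF ij(2)] mod_less_mult[OF ij(1)] mod_less_mult[OF ij(2)]
    by (auto simp: index_kron)
qed auto

section \<open>Operators placed at a single tensor factor\<close>

abbreviation (input) mat2 :: "complex mat set" where "mat2 \<equiv> carrier_mat 2 2"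
abbreviation (input) matq :: "nat \<Rightarrow> complex mat set" where "matq k \<equiv> carrier_mat (qdim k) (qdim k)"

lemma qdim_split: "i \<le> k \<Longrightarrow> 2 ^ i * 2 * 2 ^ (k - i) = qdim k"
  by (simp add: power_add[symmetric])

lemma ampl_carrier [simp]:
  assumes "X \<in> mat2" "i \<le> k" shows "ampl k i X \<in> matq k"
proof -
  show ?thesis using assms(1) qdim_split[OF assms(2)] unfolding ampl_def carrier_mat_def by auto
qed

text \<open>\<open>kron\<close> puts its left argument on the more significant digits, so this is
  the binary digit belonging to factor \<open>i\<close>, and the system (factor 0) owns the top
  digit. Digit 0 is the excited level; at a field site it therefore means a counted photon.\<close>

definition site :: "nat \<Rightarrow> nat \<Rightarrow> nat \<Rightarrow> nat" where
  "site k i r = r div 2 ^ (k - i) mod 2"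

text \<open>The two identity factors force the digits above and below factor \<open>i\<close> to
  agree; only the digit of factor \<open>i\<close> itself may change.\<close>

lemma ampl_entry:
  assumes "X \<in> mat2" "i \<le> k" "r < qdim k" "c < qdim k"
  shows "ampl k i X $$ (r, c) =
    (if r div (2 * 2 ^ (k - i)) = c div (2 * 2 ^ (k - i)) \<and> r mod 2 ^ (k - i) = c mod 2 ^ (k - i)
     then X $$ (site k i r, site k i c) else 0)"
proof -
  let ?b = "2 ^ (k - i) :: nat"
  note q = qdim_split[OF assms(2), symmetric]
  have r: "r < 2 ^ i * 2 * ?b" and c: "c < 2 ^ i * 2 * ?b" using assms q by auto
  note r1 = div_less_mult[OF r] and c1 = div_less_mult[OF c]
  note r2 = div_less_mult[OF r1] and c2 = div_less_mult[OF c1]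
  show ?thesis unfolding ampl_def
    using assms(1) r c r1 c1 r2 c2 by (auto simp: index_kron site_def div_mult2_eq mult.commute[of 2])
qed

lemma ampl_mult:
  assumes "X \<in> mat2" "Y \<in> mat2"
  shows "ampl k i (X * Y) = ampl k i X * ampl k i Y"
  using assms by (simp add: ampl_def kron_mult)

lemma ampl_one: "i \<le> k \<Longrightarrow> ampl k i (1\<^sub>m 2) = 1\<^sub>m (qdim k)"
  by (simp only: ampl_def kron_one qdim_split)

lemma ampl_adjoint: "mat_adjoint (ampl k i X) = ampl k i (mat_adjoint X)"
  by (simp add: ampl_def kron_adjoint)

lemma ampl_add:
  assumes "X \<in> mat2" "Y \<in> mat2" "i \<le> k"
  shows "ampl k i (X + Y) = ampl k i X + ampl k i Y"
proof (rule eq_matI)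
  have *: "X + Y \<in> mat2" using assms by auto
  note c = ampl_carrier[OF assms(1,3)] ampl_carrier[OF assms(2,3)] ampl_carrier[OF * assms(3)]
  show "dim_row (ampl k i (X + Y)) = dim_row (ampl k i X + ampl k i Y)"
    "dim_col (ampl k i (X + Y)) = dim_col (ampl k i X + ampl k i Y)" using c by auto
  fix r s assume "r < dim_row (ampl k i X + ampl k i Y)" "s < dim_col (ampl k i X + ampl k i Y)"
  then have rs: "r < qdim k" "s < qdim k" using c by auto
  then show "ampl k i (X + Y) $$ (r, s) = (ampl k i X + ampl k i Y) $$ (r, s)"
    using c assms * by (auto simp: ampl_entry site_def)
qed

lemma ampl_smult:
  assumes "X \<in> mat2" "i \<le> k"
  shows "ampl k i (a \<cdot>\<^sub>m X) = a \<cdot>\<^sub>m ampl k i X"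
proof (rule eq_matI)
  have *: "a \<cdot>\<^sub>m X \<in> mat2" using assms by auto
  note c = ampl_carrier[OF assms(1,2)] ampl_carrier[OF * assms(2)]
  show "dim_row (ampl k i (a \<cdot>\<^sub>m X)) = dim_row (a \<cdot>\<^sub>m ampl k i X)"
    "dim_col (ampl k i (a \<cdot>\<^sub>m X)) = dim_col (a \<cdot>\<^sub>m ampl k i X)" using c by auto
  fix r s assume "r < dim_row (a \<cdot>\<^sub>m ampl k i X)" "s < dim_col (a \<cdot>\<^sub>m ampl k i X)"
  then have rs: "r < qdim k" "s < qdim k" using c by auto
  then show "ampl k i (a \<cdot>\<^sub>m X) $$ (r, s) = (a \<cdot>\<^sub>m ampl k i X) $$ (r, s)"
    using c assms * by (auto simp: ampl_entry site_def)
qed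

text \<open>Cutting the tensor product just before factor \<open>j\<close> turns the two operators
  into \<open>kron A 1\<close> and \<open>kron 1 B\<close> with matching dimensions; both products
  are then \<open>kron A B\<close>.\<close>

lemma ampl_commute_less:
  assumes X: "X \<in> mat2" and Y: "Y \<in> mat2" and ij: "i < j" "j \<le> k"
  shows "ampl k i X * ampl k j Y = ampl k j Y * ampl k i X"
proof -
  let ?P = "kron (1\<^sub>m (2 ^ i)) X" and ?Q = "kron Y (1\<^sub>m (2 ^ (k - j)))"
  let ?m = "2 ^ (j - i - 1) :: nat"
  have "k - i = (j - i - 1) + Suc (k - j)" using ij by linarith
  then have "(2::nat) ^ (k - i) = ?m * (2 * 2 ^ (k - j))" by (simp only: power_add power_Suc)
  then have "ampl k i X = kron (kron ?P (1\<^sub>m ?m)) (1\<^sub>m (2 * 2 ^ (k - j)))"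
    by (simp add: ampl_def kron_assoc kron_one)
  moreover have "j = Suc i + (j - i - 1)" using ij by linarith
  then have "(2::nat) ^ j = 2 ^ i * 2 * ?m" by (metis power_add power_Suc2)
  then have "ampl k j Y = kron (1\<^sub>m (2 ^ i * 2 * ?m)) ?Q"
    by (simp add: ampl_def kron_assoc)
  ultimately show ?thesis
    using X Y by (simp add: kron_mult)
qed

lemma ampl_commute:
  assumes "X \<in> mat2" "Y \<in> mat2" "i \<noteq> j" "i \<le> k" "j \<le> k"
  shows "ampl k i X * ampl k j Y = ampl k j Y * ampl k i X"
  using ampl_commute_less[of X Y i j k] ampl_commute_less[of Y X j i k] assms
  by (cases "i < j") auto

subsection \<open>Diagonal matrices\<close>

definition dg :: "nat \<Rightarrow> (nat \<Rightarrow> complex) \<Rightarrow> complex mat" where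
  "dg n f = mat n n (\<lambda>(i, j). if i = j then f i else 0)"

lemma dg_carrier [simp]: "dg n f \<in> carrier_mat n n"
  and dg_dim [simp]: "dim_row (dg n f) = n" "dim_col (dg n f) = n"
  and index_dg: "i < n \<Longrightarrow> j < n \<Longrightarrow> dg n f $$ (i, j) = (if i = j then f i else 0)"
  by (auto simp: dg_def)

lemma index_dg_mult:
  assumes "A \<in> carrier_mat n m" "i < n" "j < m"
  shows "(dg n f * A) $$ (i, j) = f i * A $$ (i, j)"
proof -
  have "(dg n f * A) $$ (i, j) = (\<Sum>p<n. dg n f $$ (i, p) * A $$ (p, j))"
    using assms by (intro mat_entry_mult) auto
  also have "\<dots> = (\<Sum>p<n. if i = p then f i * A $$ (i, j) else 0)"
    using assms by (intro sum.cong) (auto simp: index_dg)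
  finally show ?thesis using assms by simp
qed

lemma dg_mult: "dg n f * dg n g = dg n (\<lambda>i. f i * g i)"
  by (rule eq_matI) (auto simp: index_dg_mult[OF dg_carrier] index_dg simp del: index_mult_mat(1))

lemma dg_add: "dg n f + dg n g = dg n (\<lambda>i. f i + g i)"
  by (rule eq_matI) (auto simp: index_dg)

lemma dg_minus: "dg n f - dg n g = dg n (\<lambda>i. f i - g i)"
  by (rule eq_matI) (auto simp: index_dg)

lemma dg_smult: "c \<cdot>\<^sub>m dg n f = dg n (\<lambda>i. c * f i)"
  by (rule eq_matI) (auto simp: index_dg)

lemma dg_one: "1\<^sub>m n = dg n (\<lambda>i. 1)"
  by (rule eq_matI) (auto simp: index_dg)

lemma dg_adjoint: "mat_adjoint (dg n f) = dg n (\<lambda>i. cnj (f i))"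
  by (rule eq_matI) (auto simp: index_dg)

lemma sigma_minus_mat: "sigma_minus = mat 2 2 (\<lambda>(i, j). if i = 1 \<and> j = 0 then 1 else 0)"
  by (rule eq_matI) (auto simp: sigma_minus_def mat_of_rows_list_def less_2_cases_iff)

lemma sigma_plus_mat: "sigma_plus = mat 2 2 (\<lambda>(i, j). if i = 0 \<and> j = 1 then 1 else 0)"
  by (rule eq_matI) (auto simp: sigma_plus_def sigma_minus_mat)

lemma sigma_carrier [simp]: "sigma_minus \<in> mat2" "sigma_plus \<in> mat2"
  by (auto simp: sigma_minus_mat sigma_plus_mat)

lemma sigma_dim [simp]:
  "dim_row sigma_minus = 2" "dim_col sigma_minus = 2" "dim_row sigma_plus = 2" "dim_col sigma_plus = 2"
  by (auto simp: sigma_minus_mat sigma_plus_mat)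

lemma sigma_plus_minus: "sigma_plus * sigma_minus = mat 2 2 (\<lambda>(i, j). if i = 0 \<and> j = 0 then 1 else 0)"
  by (rule eq_matI) (auto simp: sigma_minus_mat sigma_plus_mat scalar_prod_def numeral_2_eq_2)

lemma sigma_plus_minus_plus: "sigma_plus * sigma_minus * sigma_plus = sigma_plus"
  unfolding sigma_plus_minus
  by (rule eq_matI) (auto simp: sigma_plus_mat scalar_prod_def numeral_2_eq_2 less_Suc_eq)

text \<open>The matrix \<open>sigma_plus * sigma_minus\<close> projects onto the excited level,
  hence onto digit 0 at site \<open>m\<close>.\<close>

lemma dLambda_dg:
  assumes "m \<le> k"
  shows "dLambda k m = dg (qdim k) (\<lambda>r. if site k m r = 0 then 1 else 0)"
proof (rule eq_matI)
  have c: "dLambda k m \<in> matq k" using assms unfolding dLambda_def by (intro ampl_carrier) auto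
  then show "dim_row (dLambda k m) = dim_row (dg (qdim k) (\<lambda>r. if site k m r = 0 then 1 else 0))"
    "dim_col (dLambda k m) = dim_col (dg (qdim k) (\<lambda>r. if site k m r = 0 then 1 else 0))" by auto
  fix r s assume "r < dim_row (dg (qdim k) (\<lambda>r. if site k m r = 0 then 1 else 0))"
    "s < dim_col (dg (qdim k) (\<lambda>r. if site k m r = 0 then 1 else 0))"
  then have rs: "r < qdim k" "s < qdim k" by auto
  have lt: "site k m r < 2" "site k m s < 2" by (auto simp: site_def)
  \<comment> \<open>An index is determined by its digits above, at and below site
    \<open>m\<close>.\<close>
  have eq: "r = s" if "r div (2 * 2 ^ (k - m)) = s div (2 * 2 ^ (k - m))"
    "r mod 2 ^ (k - m) = s mod 2 ^ (k - m)" "site k m r = site k m s"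
    using that unfolding site_def
    by (metis div_mult2_eq div_mult_mod_eq mult.commute)
  show "dLambda k m $$ (r, s) = dg (qdim k) (\<lambda>r. if site k m r = 0 then 1 else 0) $$ (r, s)"
    unfolding dLambda_def sigma_plus_minus using rs lt assms eq
    by (subst ampl_entry) (auto simp: index_dg)
qed

subsection \<open>States\<close>

lemma state_add:
  "is_state n f \<Longrightarrow> A \<in> carrier_mat n n \<Longrightarrow> B \<in> carrier_mat n n \<Longrightarrow> f (A + B) = f A + f B"
  by (simp add: is_state_def)

lemma state_smult: "is_state n f \<Longrightarrow> A \<in> carrier_mat n n \<Longrightarrow> f (c \<cdot>\<^sub>m A) = c * f A"
  by (simp add: is_state_def)

lemma state_nonneg: "is_state n f \<Longrightarrow> A \<in> carrier_mat n n \<Longrightarrow> 0 \<le> f (mat_adjoint A * A)"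
  by (simp add: is_state_def less_eq_complex_def)

definition unit2 :: "nat \<Rightarrow> nat \<Rightarrow> complex mat" where
  "unit2 a b = mat 2 2 (\<lambda>(i, j). if i = a \<and> j = b then 1 else 0)"

text \<open>Serves to pull a state through a sum over many rows; the matrix units reduce this to
  exchanging finite sums of scalars.\<close>

lemma state2_expand:
  assumes "is_state 2 f" "X \<in> mat2"
  shows "f X = (\<Sum>a<2. \<Sum>b<2. X $$ (a, b) * f (unit2 a b))"
proof -
  have u: "unit2 a b \<in> mat2" for a b by (auto simp: unit2_def)
  have "X = (X $$ (0, 0) \<cdot>\<^sub>m unit2 0 0 + X $$ (0, 1) \<cdot>\<^sub>m unit2 0 1)
     + (X $$ (1, 0) \<cdot>\<^sub>m unit2 1 0 + X $$ (1, 1) \<cdot>\<^sub>m unit2 1 1)" (is "X = ?Y")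
    using assms(2) by (intro eq_matI) (auto simp: unit2_def less_2_cases_iff)
  then have "f X = f ?Y" by simp
  also have "\<dots> = X $$ (0, 0) * f (unit2 0 0) + X $$ (0, 1) * f (unit2 0 1)
     + (X $$ (1, 0) * f (unit2 1 0) + X $$ (1, 1) * f (unit2 1 1))"
    using u by (simp add: state_add[OF assms(1)] state_smult[OF assms(1)])
  finally show ?thesis by (simp add: numeral_2_eq_2)
qed

text \<open>A single row padded by a zero row: \<open>is_state\<close> grants positivity only for
  square \<open>A\<close> in \<open>mat_adjoint A * A\<close>, and this makes it applicable to the
  rows of a tall matrix.\<close>

definition row2 :: "complex mat \<Rightarrow> nat \<Rightarrow> complex mat" where
  "row2 W r = mat 2 2 (\<lambda>(i, j). if i = 0 then W $$ (r, j) else 0)"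

lemma row2_gram:
  "a < 2 \<Longrightarrow> b < 2 \<Longrightarrow> (mat_adjoint (row2 W r) * row2 W r) $$ (a, b) = cnj (W $$ (r, a)) * W $$ (r, b)"
  by (subst mat_entry_mult[where n = 2]) (auto simp: row2_def numeral_2_eq_2)

text \<open>The compression of a diagonal matrix by \<open>W\<close> is the sum of the rank-one Gram
  matrices of the rows of \<open>W\<close>, weighted by \<open>g\<close>. This is what turns
  expectations of functions of the record into weighted sums.\<close>

lemma state_diagonal_sum:
  assumes "is_state 2 f" "W \<in> carrier_mat n 2"
  shows "f (mat_adjoint W * (dg n g * W)) = (\<Sum>r<n. g r * f (mat_adjoint (row2 W r) * row2 W r))"
proof -
  have e: "(mat_adjoint W * (dg n g * W)) $$ (a, b) = (\<Sum>r<n. g r * (cnj (W $$ (r, a)) * W $$ (r, b)))"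
    if "a < 2" "b < 2" for a b
  proof -
    have "(mat_adjoint W * (dg n g * W)) $$ (a, b)
        = (\<Sum>r<n. mat_adjoint W $$ (a, r) * (dg n g * W) $$ (r, b))"
      using assms that by (intro mat_entry_mult) auto
    also have "\<dots> = (\<Sum>r<n. g r * (cnj (W $$ (r, a)) * W $$ (r, b)))"
      using assms that by (intro sum.cong) (auto simp: index_dg_mult[OF assms(2)] simp del: index_mult_mat(1))
    finally show ?thesis .
  qed
  have "f (mat_adjoint W * (dg n g * W))
      = (\<Sum>a<2. \<Sum>b<2. \<Sum>r<n. g r * (cnj (W $$ (r, a)) * W $$ (r, b)) * f (unit2 a b))"
    using assms
    by (subst state2_expand[OF assms(1)]) (auto simp: e sum_distrib_right simp del: index_mult_mat(1) intro!: sum.cong)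
  also have "\<dots> = (\<Sum>r<n. \<Sum>a<2. \<Sum>b<2. g r * (cnj (W $$ (r, a)) * W $$ (r, b)) * f (unit2 a b))"
    by (simp add: sum.distrib numeral_2_eq_2)
  also have "\<dots> = (\<Sum>r<n. g r * f (mat_adjoint (row2 W r) * row2 W r))"
  proof (intro sum.cong refl)
    fix r
    have "f (mat_adjoint (row2 W r) * row2 W r)
        = (\<Sum>a<2. \<Sum>b<2. (mat_adjoint (row2 W r) * row2 W r) $$ (a, b) * f (unit2 a b))"
      by (intro state2_expand[OF assms(1)]) (simp add: row2_def)
    then show "(\<Sum>a<2. \<Sum>b<2. g r * (cnj (W $$ (r, a)) * W $$ (r, b)) * f (unit2 a b))
        = g r * f (mat_adjoint (row2 W r) * row2 W r)"
      by (simp add: row2_gram sum_distrib_left mult.assoc del: index_mult_mat(1))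
  qed
  finally show ?thesis .
qed

definition weight :: "(complex mat \<Rightarrow> complex) \<Rightarrow> complex mat \<Rightarrow> nat \<Rightarrow> complex" where
  "weight f W r = f (mat_adjoint (row2 W r) * row2 W r)"

lemma weight_nonneg:
  assumes "is_state 2 f" shows "0 \<le> weight f W r"
proof -
  have "row2 W r \<in> mat2" by (auto simp: row2_def)
  then show ?thesis using state_nonneg[OF assms] unfolding weight_def by simp
qed

lemma state_gram_nonneg:
  assumes "is_state 2 f" "W \<in> carrier_mat n 2"
  shows "0 \<le> f (mat_adjoint W * W)"
proof -
  have "f (mat_adjoint W * W) = (\<Sum>r<n. weight f W r)"
    using state_diagonal_sum[OF assms, of "\<lambda>_. 1"] assms by (simp add: dg_one[symmetric] weight_def)
  then show ?thesis using weight_nonneg[OF assms(1)] by (simp add: sum_nonneg)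
qed

lemma mat_add_cross:
  fixes A B C D :: "complex mat"
  assumes "A \<in> carrier_mat n m" "B \<in> carrier_mat n m" "C \<in> carrier_mat n p" "D \<in> carrier_mat n p"
  shows "mat_adjoint (A + B) * (C + D)
    = (mat_adjoint A * C + mat_adjoint A * D) + (mat_adjoint B * C + mat_adjoint B * D)"
proof -
  have "mat_adjoint (A + B) * (C + D) = mat_adjoint A * (C + D) + mat_adjoint B * (C + D)"
    unfolding mat_adjoint_add[OF assms(1,2)]
    using assms by (intro add_mult_distrib_mat[where nr = m and n = n and nc = p]) auto
  also have "mat_adjoint A * (C + D) = mat_adjoint A * C + mat_adjoint A * D"
    using assms by (intro mult_add_distrib_mat[where nr = m and n = n and nc = p]) auto
  also have "mat_adjoint B * (C + D) = mat_adjoint B * C + mat_adjoint B * D"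
    using assms by (intro mult_add_distrib_mat[where nr = m and n = n and nc = p]) auto
  finally show ?thesis .
qed

text \<open>The degenerate case of Cauchy-Schwarz. Expanding the positive value at c A + B, the term
  quadratic in c vanishes by \<open>null\<close>; what remains is affine in c and bounded below, so
  its linear part is zero.\<close>

lemma state_null_left:
  assumes st: "is_state 2 f" and A: "A \<in> carrier_mat n 2" and B: "B \<in> carrier_mat n 2"
    and null: "f (mat_adjoint A * A) = 0"
  shows "f (mat_adjoint A * B) = 0"
proof -
  define s t b where "s = f (mat_adjoint A * B)" and "t = f (mat_adjoint B * A)"
    and "b = f (mat_adjoint B * B)"
  have pos: "0 \<le> cnj c * s + c * t + b" for c
  proof -
    have C: "c \<cdot>\<^sub>m A \<in> carrier_mat n 2" using A by simp
    have "mat_adjoint (c \<cdot>\<^sub>m A) * (c \<cdot>\<^sub>m A) = (cnj c * c) \<cdot>\<^sub>m (mat_adjoint A * A)"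
      "mat_adjoint (c \<cdot>\<^sub>m A) * B = cnj c \<cdot>\<^sub>m (mat_adjoint A * B)"
      "mat_adjoint B * (c \<cdot>\<^sub>m A) = c \<cdot>\<^sub>m (mat_adjoint B * A)"
      using A B by (auto simp: mat_adjoint_smult mult_smult_distrib[where n = n] mult_smult_assoc_mat[where n = n])
    then have "f (mat_adjoint (c \<cdot>\<^sub>m A + B) * (c \<cdot>\<^sub>m A + B)) = cnj c * s + (c * t + b)"
      using A B null unfolding mat_add_cross[OF C B C B]
      by (simp add: state_add[OF st] state_smult[OF st] s_def t_def b_def)
    moreover have "c \<cdot>\<^sub>m A + B \<in> carrier_mat n 2" using A B by simp
    ultimately show ?thesis using state_gram_nonneg[OF st] by (metis add.assoc)
  qed
  have lin: "u = 0" if "\<And>x::real. 0 \<le> x * u + v" for u v :: real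
  proof (rule ccontr)
    assume "u \<noteq> 0"
    \<comment> \<open>This choice of x makes the affine function equal to -1.\<close>
    then show False using that[of "- (v + 1) / u"] by simp
  qed
  \<comment> \<open>Real c isolates s + t and imaginary c isolates t - s. The complex order also
    forces imaginary parts to vanish, which settles the other components.\<close>
  have re: "0 \<le> x * Re (s + t) + Re b" "x * Im (s + t) + Im b = 0" for x
    using pos[of "of_real x"] by (auto simp: less_eq_complex_def algebra_simps)
  have im: "0 \<le> x * Re (\<i> * (t - s)) + Re b" "x * Im (\<i> * (t - s)) + Im b = 0" for x
    using pos[of "\<i> * of_real x"] by (auto simp: less_eq_complex_def algebra_simps)
  have "Re (s + t) = 0" "Im (s + t) = 0" "Re (\<i> * (t - s)) = 0" "Im (\<i> * (t - s)) = 0"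
    using lin[OF re(1)] lin[OF im(1)] re(2)[of 0] re(2)[of 1] im(2)[of 1] by auto
  then show ?thesis unfolding s_def[symmetric] by (simp add: complex_eq_iff)
qed

subsection \<open>The vacuum\<close>

text \<open>The embedding V of the overview in coordinates: column \<open>a\<close> is the basis
  vector with system digit \<open>a\<close> followed by \<open>k\<close> digits 1, whose index is a
  2^k + (2^k - 1).\<close>

definition vac :: "nat \<Rightarrow> complex mat" where
  "vac k = mat (qdim k) 2 (\<lambda>(r, a). if r = a * 2 ^ k + (2 ^ k - 1) then 1 else 0)"

lemma vac_carrier [simp]: "vac k \<in> carrier_mat (qdim k) 2"
  by (simp add: vac_def)

lemma vacuum_eq: "X \<in> mat2 \<Longrightarrow> vacuum X = X $$ (1, 1)"
  by (auto simp: vacuum_def Phi_def scalar_prod_def numeral_2_eq_2)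

lemma vacuum_pow_eq: "vacuum_pow k A = A $$ (2 ^ k - 1, 2 ^ k - 1)"
proof (induction k arbitrary: A)
  case (Suc k)
  have "2 ^ k + (2 ^ k - 1) = 2 * 2 ^ k - (1 :: nat)" by simp
  then show ?case by (simp add: tensor_functional_def vacuum_eq Suc)
qed simp

lemma last_index_less: "a < 2 \<Longrightarrow> a * 2 ^ k + (2 ^ k - 1) < qdim k"
proof -
  have "0 < (2::nat) ^ k" by simp
  then have "2 ^ k - 1 < 2 * (2::nat) ^ k" "2 ^ k + (2 ^ k - 1) < 2 * (2::nat) ^ k" by linarith+
  then show "a < 2 \<Longrightarrow> a * 2 ^ k + (2 ^ k - 1) < qdim k"
    by (auto simp: less_2_cases_iff)
qed

lemma index_mult_vac:
  assumes "A \<in> carrier_mat n (qdim k)" "r < n" "a < 2"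
  shows "(A * vac k) $$ (r, a) = A $$ (r, a * 2 ^ k + (2 ^ k - 1))"
proof -
  let ?s = "a * 2 ^ k + (2 ^ k - 1)"
  have "(A * vac k) $$ (r, a) = (\<Sum>p<qdim k. A $$ (r, p) * vac k $$ (p, a))"
    using assms vac_carrier[of k] by (intro mat_entry_mult) (auto simp del: vac_carrier)
  also have "\<dots> = (\<Sum>p<qdim k. if p = ?s then A $$ (r, ?s) else 0)"
    using assms by (intro sum.cong) (auto simp: vac_def)
  finally show ?thesis using last_index_less[OF assms(3), of k] by simp
qed

lemma PP_eq:
  assumes "A \<in> matq k"
  shows "PP \<rho> k A = \<rho> (mat_adjoint (vac k) * (A * vac k))"
proof -
  have "mat 2 2 (\<lambda>(i, j). A $$ (i * 2 ^ k + (2 ^ k - 1), j * 2 ^ k + (2 ^ k - 1)))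
      = mat_adjoint (vac k) * (A * vac k)" (is "?L = ?R")
  proof (rule eq_matI)
    have vd: "dim_row (vac k) = qdim k" "dim_col (vac k) = 2" by (auto simp: vac_def)
    show "dim_row ?L = dim_row ?R" "dim_col ?L = dim_col ?R" using vd by auto
    fix a b assume "a < dim_row ?R" "b < dim_col ?R"
    then have ab: "a < 2" "b < 2" using vd by auto
    let ?s = "\<lambda>a. a * 2 ^ k + (2 ^ k - 1) :: nat"
    have "?R $$ (a, b) = (\<Sum>p<qdim k. mat_adjoint (vac k) $$ (a, p) * (A * vac k) $$ (p, b))"
      using assms ab vd by (intro mat_entry_mult) auto
    also have "\<dots> = (\<Sum>p<qdim k. if p = ?s a then A $$ (?s a, ?s b) else 0)"
      using assms ab vd by (intro sum.cong)
        (auto simp: index_mult_vac[OF assms] simp del: index_mult_mat(1), auto simp: vac_def)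
    also have "\<dots> = A $$ (?s a, ?s b)" using last_index_less[OF ab(1), of k] by simp
    finally show "?L $$ (a, b) = ?R $$ (a, b)" using ab by simp
  qed
  then show ?thesis
    by (simp add: PP_def tensor_functional_def vacuum_pow_eq)
qed

text \<open>The index equals (a + 1) 2^k - 1, whose last \<open>k\<close> binary digits are 1. Its
  quotient by 2^(k - l) is the odd number \<open>m\<close> below.\<close>

lemma site_vac:
  assumes "1 \<le> l" "l \<le> k"
  shows "site k l (a * 2 ^ k + (2 ^ k - 1)) = 1"
proof -
  let ?b = "2 ^ (k - l) :: nat"
  define m where "m = 2 * ((a + 1) * 2 ^ (l - 1)) - (1 :: nat)"
  have pos: "0 < (a + 1) * 2 ^ (l - 1)" by simp
  have "(2::nat) ^ k = 2 ^ (k - l) * 2 ^ l" using assms by (simp flip: power_add)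
  also have "(2::nat) ^ l = 2 * 2 ^ (l - 1)" using assms by (simp flip: power_Suc)
  finally have k: "(2::nat) ^ k = ?b * (2 * 2 ^ (l - 1))" .
  have "a * 2 ^ k + (2 ^ k - 1) = (a + 1) * 2 ^ k - (1 :: nat)" by simp
  also have "\<dots> = ?b * (2 * ((a + 1) * 2 ^ (l - 1))) - 1" by (simp add: k algebra_simps)
  also have "\<dots> = (?b - 1) + m * ?b"
  proof -
    have "2 * ((a + 1) * 2 ^ (l - 1)) = Suc m" using pos by (simp add: m_def)
    moreover have "0 < ?b" by simp
    ultimately show ?thesis by (simp only: mult_Suc_right) (simp add: mult.commute)
  qed
  finally have "(a * 2 ^ k + (2 ^ k - 1)) div ?b = ((?b - 1) + m * ?b) div ?b" by (simp only:)
  also have "\<dots> = m + (?b - 1) div ?b" by (rule div_mult_self1) simp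
  also have "\<dots> = m" by simp
  finally have "(a * 2 ^ k + (2 ^ k - 1)) div ?b = m" .
  moreover have "odd m" using pos by (simp add: m_def)
  ultimately show ?thesis by (simp add: site_def odd_iff_mod_2_eq_one)
qed

text \<open>The two entries assumed to vanish form the column X Phi, so \<open>X\<close> kills the
  vacuum of its own factor.\<close>

lemma ampl_mult_vac_zero:
  assumes "1 \<le> l" "l \<le> k" "X \<in> mat2" "X $$ (0, 1) = 0" "X $$ (1, 1) = 0"
  shows "ampl k l X * vac k = 0\<^sub>m (qdim k) 2"
proof (rule eq_matI)
  note c = ampl_carrier[OF assms(3,2)]
  have vd: "dim_row (vac k) = qdim k" "dim_col (vac k) = 2" by (auto simp: vac_def)
  show "dim_row (ampl k l X * vac k) = dim_row (0\<^sub>m (qdim k) 2)"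
    "dim_col (ampl k l X * vac k) = dim_col (0\<^sub>m (qdim k) 2)" using c vd by auto
  fix r a assume "r < dim_row (0\<^sub>m (qdim k) 2 :: complex mat)" "a < dim_col (0\<^sub>m (qdim k) 2 :: complex mat)"
  then have ra: "r < qdim k" "a < 2" by auto
  have "site k l r < 2" by (simp add: site_def)
  then have "X $$ (site k l r, 1) = 0" using assms(4,5) by (auto simp: less_2_cases_iff)
  then show "(ampl k l X * vac k) $$ (r, a) = 0\<^sub>m (qdim k) 2 $$ (r, a)"
    using ra assms last_index_less[OF ra(2), of k] site_vac[OF assms(1,2), of a]
    by (simp add: index_mult_vac[OF c] ampl_entry del: index_mult_mat(1) power_Suc)
qed

section \<open>Distributive, scalar and commutation rules for matrix products\<close>

lemma mat_add_mult:
  fixes A B C :: "complex mat"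
  assumes "dim_row A = dim_row B" "dim_col A = dim_col B" "dim_col A = dim_row C"
  shows "(A + B) * C = A * C + B * C"
  using assms by (intro add_mult_distrib_mat) auto

lemma mat_mult_add:
  fixes A B C :: "complex mat"
  assumes "dim_row B = dim_row C" "dim_col B = dim_col C" "dim_col A = dim_row B"
  shows "A * (B + C) = A * B + A * C"
  using assms by (intro mult_add_distrib_mat) auto

lemma mat_minus_mult:
  fixes A B C :: "complex mat"
  assumes "dim_row A = dim_row B" "dim_col A = dim_col B" "dim_col A = dim_row C"
  shows "(A - B) * C = A * C - B * C"
  using assms by (intro minus_mult_distrib_mat) auto

lemma mat_mult_minus:
  fixes A B C :: "complex mat"
  assumes "dim_row B = dim_row C" "dim_col B = dim_col C" "dim_col A = dim_row B"
  shows "A * (B - C) = A * B - A * C"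
  using assms by (intro mult_minus_distrib_mat) auto

lemma mat_smult_mult:
  fixes A B :: "complex mat"
  assumes "dim_col A = dim_row B" shows "(c \<cdot>\<^sub>m A) * B = c \<cdot>\<^sub>m (A * B)"
  using assms by (intro mult_smult_assoc_mat) auto

lemma mat_mult_smult:
  fixes A B :: "complex mat"
  assumes "dim_col A = dim_row B" shows "A * (c \<cdot>\<^sub>m B) = c \<cdot>\<^sub>m (A * B)"
  using assms by (intro mult_smult_distrib) auto

lemma mat_smult_smult:
  fixes A :: "complex mat" shows "a \<cdot>\<^sub>m (b \<cdot>\<^sub>m A) = (a * b) \<cdot>\<^sub>m A"
  by (rule eq_matI) auto

lemma cnj_lam [simp]: "cnj (lam k T) = lam k T"
  by (simp add: lam_def)

lemma commute_mult:
  fixes A B C :: "complex mat"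
  assumes "A * C = C * A" "B * C = C * B" "A \<in> carrier_mat n n" "B \<in> carrier_mat n n" "C \<in> carrier_mat n n"
  shows "(A * B) * C = C * (A * B)"
proof -
  have "(A * B) * C = A * (B * C)" using assms by (intro assoc_mult_mat) auto
  also have "\<dots> = (A * C) * B" unfolding assms(2) using assms by (intro assoc_mult_mat[symmetric]) auto
  also have "\<dots> = C * (A * B)" unfolding assms(1) using assms by (intro assoc_mult_mat) auto
  finally show ?thesis .
qed

lemma commute_add:
  fixes A B C :: "complex mat"
  assumes "A * C = C * A" "B * C = C * B" "A \<in> carrier_mat n n" "B \<in> carrier_mat n n" "C \<in> carrier_mat n n"
  shows "(A + B) * C = C * (A + B)"
  using assms by (simp add: mat_add_mult mat_mult_add)

lemma commute_smult:
  fixes A C :: "complex mat"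
  assumes "A * C = C * A" "A \<in> carrier_mat n n" "C \<in> carrier_mat n n"
  shows "(c \<cdot>\<^sub>m A) * C = C * (c \<cdot>\<^sub>m A)"
  using assms by (simp add: mat_smult_mult mat_mult_smult)

declare evol.simps(1) [simp del]

lemma mat_add_right_commute:
  fixes A B C :: "complex mat"
  assumes "A \<in> carrier_mat n m" "B \<in> carrier_mat n m" "C \<in> carrier_mat n m"
  shows "A + B + C = A + C + B"
  using assms by (intro eq_matI) auto

section \<open>The unitary dynamics of the repeated interaction\<close>

locale repeated_interaction =
  fixes k :: nat and T :: real and \<rho> :: "complex mat \<Rightarrow> complex"
    and L1 L2 L3 Mpm Mp Mm Mo :: "complex mat"
  assumes state: "is_state 2 \<rho>"
    and L [simp]: "L1 \<in> mat2" "L2 \<in> mat2" "L3 \<in> mat2"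
    and L_adj: "mat_adjoint L1 = L1" "mat_adjoint L3 = L3"
    and Ms [simp]: "Mpm \<in> mat2" "Mp \<in> mat2" "Mm \<in> mat2" "Mo \<in> mat2"
    and coefficients: "\<And>l. l \<in> {1..k} \<Longrightarrow>
           interaction k T L1 L2 L3 l - 1\<^sub>m (qdim k) =
             ampl k 0 Mpm * dLambda k l + ampl k 0 Mp * dAs k T l
             + ampl k 0 Mm * dA k T l + ampl k 0 Mo * dt k T l"
begin

text \<open>The dimension is hidden behind a constant because the simplifier rewrites \<open>2 ^ Suc k\<close>,
  after which carrier and dimension rules stated with it no longer match.\<close>

definition N :: nat where "N = 2 ^ Suc k"

lemma ampl_N [simp]:
  assumes "X \<in> mat2" "i \<le> k"
  shows "ampl k i X \<in> carrier_mat N N" "dim_row (ampl k i X) = N" "dim_col (ampl k i X) = N"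
  using ampl_carrier[OF assms] by (auto simp: N_def)

lemma ampl_one_N [simp]: "i \<le> k \<Longrightarrow> ampl k i (1\<^sub>m 2) = 1\<^sub>m N"
  unfolding N_def by (rule ampl_one)

lemma dLambda_N [simp]:
  assumes "l \<le> k"
  shows "dLambda k l \<in> carrier_mat N N" "dim_row (dLambda k l) = N" "dim_col (dLambda k l) = N"
  using assms by (simp_all add: dLambda_def)

lemma dLambda_dg_N: "m \<le> k \<Longrightarrow> dLambda k m = dg N (\<lambda>r. if site k m r = 0 then 1 else 0)"
  unfolding N_def by (rule dLambda_dg)

lemma dt_N: "dt k T i = (lam k T)\<^sup>2 \<cdot>\<^sub>m 1\<^sub>m N"
  unfolding N_def by (rule dt_def)

lemma vac_N [simp]: "vac k \<in> carrier_mat N 2" "dim_row (vac k) = N" "dim_col (vac k) = 2"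
  by (auto simp: vac_def N_def)

abbreviation "M \<equiv> interaction k T L1 L2 L3"
abbreviation "U \<equiv> evol k T L1 L2 L3"
abbreviation "w \<equiv> (lam k T)\<^sup>2"
abbreviation "sys \<equiv> ampl k 0"

lemma Ms_dim [simp]:
  "dim_row Mpm = 2" "dim_col Mpm = 2" "dim_row Mp = 2" "dim_col Mp = 2"
  "dim_row Mm = 2" "dim_col Mm = 2" "dim_row Mo = 2" "dim_col Mo = 2"
  by (simp_all add: carrier_matD[OF Ms(1)] carrier_matD[OF Ms(2)] carrier_matD[OF Ms(3)] carrier_matD[OF Ms(4)])

text \<open>\<open>No\<close> is the system part of the interaction when no photon is counted.\<close>

definition No :: "complex mat" where "No = 1\<^sub>m 2 + w \<cdot>\<^sub>m Mo"

lemma No_carrier [simp]: "No \<in> mat2" "dim_row No = 2" "dim_col No = 2"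
  by (simp_all add: No_def)

lemma M_carrier [simp]:
  assumes "l \<le> k" shows "M l \<in> carrier_mat N N"
  unfolding interaction_def using assms by (intro mat_exp_carrier) (simp add: dt_N)

lemma M_dim [simp]: "l \<le> k \<Longrightarrow> dim_row (M l) = N" "l \<le> k \<Longrightarrow> dim_col (M l) = N"
  by (simp_all add: carrier_matD[OF M_carrier])

text \<open>The exponent is -i times a self-adjoint \<open>H\<close>: system and field operators
  commute, so taking adjoints fixes the first and last terms of \<open>H\<close> and exchanges the
  two in the middle.\<close>

lemma M_unitary:
  assumes l: "1 \<le> l" "l \<le> k"
  shows "M l * mat_adjoint (M l) = 1\<^sub>m N" "mat_adjoint (M l) * M l = 1\<^sub>m N"
proof -
  define H where "H = sys L1 * dLambda k l + sys L2 * dAs k T l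
      + sys (mat_adjoint L2) * dA k T l + sys L3 * dt k T l"
  have adj: "mat_adjoint (sys X * (lam k T \<cdot>\<^sub>m ampl k l Y))
      = sys (mat_adjoint X) * (lam k T \<cdot>\<^sub>m ampl k l (mat_adjoint Y))"
    if "X \<in> mat2" "Y \<in> mat2" for X Y
    using that l ampl_commute[of "mat_adjoint X" "mat_adjoint Y" 0 l k]
    by (simp add: mat_adjoint_mult mat_adjoint_smult ampl_adjoint mat_smult_mult mat_mult_smult)
  have "mat_adjoint (sys L1 * dLambda k l) = dLambda k l * sys L1"
    using l by (simp add: mat_adjoint_mult ampl_adjoint L_adj dLambda_dg_N dg_adjoint if_distrib cong: if_cong)
  also have "\<dots> = sys L1 * dLambda k l"
    unfolding dLambda_def using l ampl_commute[of L1 "sigma_plus * sigma_minus" 0 l k] by simp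
  finally have 1: "mat_adjoint (sys L1 * dLambda k l) = sys L1 * dLambda k l" .
  have 2: "mat_adjoint (sys L2 * dAs k T l) = sys (mat_adjoint L2) * dA k T l"
    unfolding dAs_def dA_def by (subst adj) (simp_all add: sigma_plus_def)
  have 3: "mat_adjoint (sys (mat_adjoint L2) * dA k T l) = sys L2 * dAs k T l"
    unfolding dAs_def dA_def by (subst adj) (simp_all add: sigma_plus_def)
  have 4: "mat_adjoint (sys L3 * dt k T l) = sys L3 * dt k T l"
    by (simp add: dt_N mat_mult_smult mat_adjoint_smult ampl_adjoint L_adj)
  have c: "sys L1 * dLambda k l \<in> carrier_mat N N" "sys L2 * dAs k T l \<in> carrier_mat N N"
    "sys (mat_adjoint L2) * dA k T l \<in> carrier_mat N N" "sys L3 * dt k T l \<in> carrier_mat N N"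
    using l by (simp_all add: dt_N dA_def dAs_def)
  have H: "H \<in> carrier_mat N N" using c by (simp add: H_def)
  have "mat_adjoint H = (sys L1 * dLambda k l + sys (mat_adjoint L2) * dA k T l)
      + sys L2 * dAs k T l + sys L3 * dt k T l"
    unfolding H_def using c by (simp add: mat_adjoint_add[where n = "N" and m = "N"] 1 2 3 4)
  also have "\<dots> = H"
    unfolding H_def using c
    by (subst mat_add_right_commute[of _ N N "sys (mat_adjoint L2) * dA k T l"]) auto
  finally have "mat_adjoint ((- \<i>) \<cdot>\<^sub>m H) = (-1) \<cdot>\<^sub>m ((- \<i>) \<cdot>\<^sub>m H)"
    by (simp add: mat_adjoint_smult mat_smult_smult)
  from mat_exp_skew_unitary[OF _ this, of "N"] H
  show "M l * mat_adjoint (M l) = 1\<^sub>m N" "mat_adjoint (M l) * M l = 1\<^sub>m N"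
    unfolding interaction_def H_def[symmetric] by simp_all
qed

text \<open>The time increment is a scalar, so the identity and the \<open>Mo\<close> term both act
  on the system alone and merge into \<open>No\<close>.\<close>

lemma M_decompose:
  assumes "l \<in> {1..k}"
  shows "M l = (sys Mpm * dLambda k l + lam k T \<cdot>\<^sub>m (sys Mp * ampl k l sigma_plus)
             + lam k T \<cdot>\<^sub>m (sys Mm * ampl k l sigma_minus)) + sys No"
proof -
  have l: "l \<le> k" using assms by simp
  let ?B = "sys Mpm * dLambda k l + sys Mp * dAs k T l + sys Mm * dA k T l"
  have B: "?B \<in> carrier_mat N N" using l by (simp add: dA_def)
  have "M l = (M l - 1\<^sub>m N) + 1\<^sub>m N"
    using M_carrier[OF l] by (intro eq_matI) auto
  also have "\<dots> = ?B + sys Mo * dt k T l + 1\<^sub>m N"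
    using coefficients[OF assms] unfolding N_def by simp
  also have "\<dots> = ?B + (sys Mo * dt k T l + 1\<^sub>m N)"
    using B l by (intro assoc_add_mat) (auto simp: dt_N)
  also have "sys Mo * dt k T l + 1\<^sub>m N = sys No"
    unfolding No_def using l
    by (simp add: ampl_add ampl_smult dt_N mat_mult_smult)
      (intro comm_add_mat[where nr = "N" and nc = "N"], auto)
  finally show ?thesis using l by (simp add: dAs_def dA_def mat_mult_smult)
qed

text \<open>The expansion of \<open>M l\<close> in the coefficient matrices involves only factors 0
  and \<open>l\<close>; locality is read off from it without touching the exponential.\<close>

lemma M_commute:
  assumes "l \<in> {1..k}" "m \<in> {1..k}" "l \<noteq> m" and Y: "Y \<in> mat2"
  shows "M l * ampl k m Y = ampl k m Y * M l"
proof -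
  have s: "sys X * ampl k m Y = ampl k m Y * sys X" if "X \<in> mat2" for X
    using assms that by (intro ampl_commute) auto
  have f: "ampl k l X * ampl k m Y = ampl k m Y * ampl k l X" if "X \<in> mat2" for X
    using assms that by (intro ampl_commute) auto
  have lm: "l \<le> k" "m \<le> k" using assms by auto
  show ?thesis
    unfolding M_decompose[OF assms(1)] dLambda_def
    using lm Y
    by (intro commute_add[where n = "N"] commute_mult[where n = "N"]
        commute_smult[where n = "N"] s f) auto
qed

lemma U_0 [simp]: "U 0 = 1\<^sub>m N"
  by (simp add: N_def evol.simps(1))

lemma U_carrier [simp]: "l \<le> k \<Longrightarrow> U l \<in> carrier_mat N N"
  by (induction l) auto

lemma U_dim [simp]: "l \<le> k \<Longrightarrow> dim_row (U l) = N" "l \<le> k \<Longrightarrow> dim_col (U l) = N"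
  by (simp_all add: carrier_matD[OF U_carrier])

lemma U_unitary:
  assumes "l \<le> k" shows "mat_adjoint (U l) * U l = 1\<^sub>m N" "U l * mat_adjoint (U l) = 1\<^sub>m N"
proof -
  show *: "mat_adjoint (U l) * U l = 1\<^sub>m N"
    using assms
  proof (induction l)
    case (Suc l)
    have "mat_adjoint (U (Suc l)) * U (Suc l) = mat_adjoint (U l) * ((mat_adjoint (M (Suc l)) * M (Suc l)) * U l)"
      using Suc by (simp add: mat_adjoint_mult mat_assoc)
    then show ?case using Suc M_unitary[of "Suc l"] by simp
  qed simp
  show "U l * mat_adjoint (U l) = 1\<^sub>m N"
    using mat_mult_left_right_inverse[OF _ _ *] assms by simp
qed

lemma U_commute:
  assumes "l < m" "m \<le> k" "Y \<in> mat2"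
  shows "U l * ampl k m Y = ampl k m Y * U l"
  using assms
proof (induction l)
  case (Suc l)
  then show ?case
    unfolding evol.simps(2)
    by (intro commute_mult[where n = "N"] M_commute) auto
qed simp

text \<open>Since later interactions commute with the factors already measured, the output up to a given
  time may be rotated back by the final unitary instead of the current one.\<close>

lemma conj_U_stable:
  assumes "m \<le> l" "l \<le> k" "Z \<in> carrier_mat N N"
    and "\<And>j. m < j \<Longrightarrow> j \<le> l \<Longrightarrow> M j * Z = Z * M j"
  shows "mat_adjoint (U l) * (Z * U l) = mat_adjoint (U m) * (Z * U m)"
  using assms
proof (induction l)
  case (Suc l)
  show ?case
  proof (cases "m = Suc l")
    case False
    have "mat_adjoint (U (Suc l)) * (Z * U (Suc l))
        = mat_adjoint (U l) * (mat_adjoint (M (Suc l)) * ((Z * M (Suc l)) * U l))"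
      using Suc.prems by (simp add: mat_adjoint_mult mat_assoc)
    also have "Z * M (Suc l) = M (Suc l) * Z" using Suc.prems False by simp
    also have "mat_adjoint (M (Suc l)) * ((M (Suc l) * Z) * U l)
        = (mat_adjoint (M (Suc l)) * M (Suc l)) * (Z * U l)"
      using Suc.prems by (simp add: mat_assoc)
    also have "\<dots> = Z * U l" using Suc.prems M_unitary[of "Suc l"] by simp
    also have "mat_adjoint (U l) * (Z * U l) = mat_adjoint (U m) * (Z * U m)"
      using Suc False by simp
    finally show ?thesis .
  qed simp
qed simp

subsection \<open>Measurement records\<close>

text \<open>A basis index stands for a record through its field digits. Site 0 is left out, since
  the system digit is not observed; different indices may thus carry the same full record.\<close>

definition agree :: "nat \<Rightarrow> nat \<Rightarrow> nat \<Rightarrow> bool" where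
  "agree l i r \<longleftrightarrow> (\<forall>m\<in>{1..l}. site k m r = site k m i)"

definition ind :: "nat \<Rightarrow> nat \<Rightarrow> nat \<Rightarrow> complex" where
  "ind l i r = (if agree l i r then 1 else 0)"

abbreviation "F l i \<equiv> dg N (ind l i)"

lemma F_0: "F 0 i = 1\<^sub>m N"
  by (simp add: dg_one ind_def[abs_def] agree_def)

lemma ind_Suc:
  "ind (Suc l) i = (\<lambda>r. (if site k (Suc l) i = 0 then (if site k (Suc l) r = 0 then 1 else 0)
     else 1 - (if site k (Suc l) r = 0 then 1 else 0)) * ind l i r)"
proof
  fix r
  have bit: "site k m x = 0 \<or> site k m x = 1" for m x by (auto simp: site_def)
  have "agree (Suc l) i r \<longleftrightarrow> agree l i r \<and> site k (Suc l) r = site k (Suc l) i"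
    by (auto simp: agree_def le_Suc_eq)
  then show "ind (Suc l) i r = (if site k (Suc l) i = 0 then (if site k (Suc l) r = 0 then 1 else 0)
     else 1 - (if site k (Suc l) r = 0 then 1 else 0)) * ind l i r"
    using bit[of "Suc l" i] bit[of "Suc l" r] by (elim disjE) (simp_all add: ind_def)
qed

text \<open>The projection onto the outcome that index \<open>i\<close> prescribes at site
  \<open>l\<close>, written through \<open>dLambda\<close> so that commutation and vacuum relations
  apply to it directly.\<close>

definition gate :: "nat \<Rightarrow> nat \<Rightarrow> complex mat" where
  "gate l i = (if site k l i = 0 then dLambda k l else 1\<^sub>m N - dLambda k l)"

lemma F_Suc:
  assumes "Suc l \<le> k"
  shows "F (Suc l) i = gate (Suc l) i * F l i"
  unfolding gate_def dLambda_dg_N[OF assms] dg_one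
  by (simp add: dg_minus dg_mult ind_Suc)

lemma commute_gate:
  assumes "Z \<in> carrier_mat N N" "Z * dLambda k m = dLambda k m * Z" "m \<le> k"
  shows "Z * gate m i = gate m i * Z"
  using assms by (auto simp: gate_def mat_mult_minus mat_minus_mult)

lemma gate_carrier [simp]: "m \<le> k \<Longrightarrow> gate m i \<in> carrier_mat N N"
  by (simp add: gate_def minus_carrier_mat)

lemma commute_F:
  assumes "Z \<in> carrier_mat N N" "l \<le> k" "\<And>m. m \<in> {1..l} \<Longrightarrow> Z * dLambda k m = dLambda k m * Z"
  shows "Z * F l i = F l i * Z"
  using assms(2,3)
proof (induction l)
  case 0
  then show ?case using assms(1) by (simp add: F_0)
next
  case (Suc l)
  have "gate (Suc l) i * Z = Z * gate (Suc l) i" "F l i * Z = Z * F l i"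
    using Suc assms(1) commute_gate[of Z "Suc l" i] by auto
  from commute_mult[OF this, of "N"] show ?case
    using assms(1) Suc.prems by (simp add: F_Suc)
qed

lemma dLambda_ampl: "dLambda k m = ampl k m (sigma_plus * sigma_minus)"
  by (simp add: dLambda_def)

lemma ampl_commute_F:
  assumes "j \<le> k" "l \<le> k" "j \<notin> {1..l}" "X \<in> mat2"
  shows "ampl k j X * F l i = F l i * ampl k j X"
proof (rule commute_F)
  fix m assume "m \<in> {1..l}"
  then show "ampl k j X * dLambda k m = dLambda k m * ampl k j X"
    unfolding dLambda_ampl using assms by (intro ampl_commute) auto
qed (use assms in auto)

lemma M_commute_F:
  assumes "l < j" "j \<le> k"
  shows "M j * F l i = F l i * M j"
proof (rule commute_F)
  fix m assume "m \<in> {1..l}"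
  then show "M j * dLambda k m = dLambda k m * M j"
    unfolding dLambda_ampl using assms by (intro M_commute) auto
qed (use assms in auto)

section \<open>One-step propagation of the conditioned vacuum\<close>

definition W :: "nat \<Rightarrow> nat \<Rightarrow> complex mat" where
  "W l i = F l i * (U l * vac k)"

lemma W_carrier [simp]: "l \<le> k \<Longrightarrow> W l i \<in> carrier_mat N 2"
  by (simp add: W_def)

lemma W_dim [simp]: "dim_row (W l i) = N" "dim_col (W l i) = 2"
  by (simp_all add: W_def)

text \<open>Before time \<open>m\<close> the factor \<open>m\<close> is untouched, so the operator
  passes through \<open>F l i\<close> and \<open>U l\<close> and meets the vacuum.\<close>

lemma field_annihilates_W:
  assumes "l < m" "m \<le> k" "X \<in> mat2" "X $$ (0, 1) = 0" "X $$ (1, 1) = 0"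
  shows "ampl k m X * W l i = 0\<^sub>m N 2"
proof -
  have "ampl k m X * W l i = (ampl k m X * F l i) * (U l * vac k)"
    using assms by (simp add: W_def mat_assoc)
  also have "ampl k m X * F l i = F l i * ampl k m X"
    using assms by (intro ampl_commute_F) auto
  also have "(F l i * ampl k m X) * (U l * vac k) = F l i * ((ampl k m X * U l) * vac k)"
    using assms by (simp add: mat_assoc)
  also have "ampl k m X * U l = U l * ampl k m X"
    using assms U_commute by simp
  also have "(U l * ampl k m X) * vac k = U l * (ampl k m X * vac k)"
    using assms by (simp add: mat_assoc)
  also have "ampl k m X * vac k = 0\<^sub>m N 2"
    unfolding N_def using assms by (intro ampl_mult_vac_zero) auto
  finally show ?thesis using assms by simp
qed

lemma dLambda_W: "l < k \<Longrightarrow> dLambda k (Suc l) * W l i = 0\<^sub>m N 2"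
  unfolding dLambda_ampl by (rule field_annihilates_W) (auto simp: sigma_plus_minus)

lemma sigma_minus_W: "l < k \<Longrightarrow> ampl k (Suc l) sigma_minus * W l i = 0\<^sub>m N 2"
  by (rule field_annihilates_W) (auto simp: sigma_minus_mat)

definition W1 :: "nat \<Rightarrow> nat \<Rightarrow> complex mat" where
  "W1 l i = lam k T \<cdot>\<^sub>m (sys Mp * (ampl k (Suc l) sigma_plus * W l i))"

definition W0 :: "nat \<Rightarrow> nat \<Rightarrow> complex mat" where
  "W0 l i = sys No * W l i"

lemma W1_W0_carrier [simp]: "W1 l i \<in> carrier_mat N 2" "W0 l i \<in> carrier_mat N 2"
  by (simp_all add: W1_def W0_def)

lemma W1_W0_dim [simp]: "dim_row (W1 l i) = N" "dim_col (W1 l i) = 2"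
  "dim_row (W0 l i) = N" "dim_col (W0 l i) = 2"
  by (simp_all add: W1_def W0_def)

text \<open>The counting and lowering operators annihilate the fresh factor, which removes the terms
  with \<open>Mpm\<close> and \<open>Mm\<close>; \<open>W1\<close> carries an emitted photon and
  \<open>W0\<close> none.\<close>

lemma M_W:
  assumes "l < k" shows "M (Suc l) * W l i = W1 l i + W0 l i"
proof -
  have l: "Suc l \<in> {1..k}" "Suc l \<le> k" "l \<le> k" using assms by auto
  have z: "sys X * 0\<^sub>m N 2 = 0\<^sub>m N 2" if "X \<in> mat2" for X
    using that by simp
  show ?thesis
    unfolding M_decompose[OF l(1)] W1_def W0_def using l
    by (simp add: mat_add_mult mat_smult_mult mat_assoc dLambda_W sigma_minus_W z assms)
qed

lemma dLambda_W1:
  assumes "l < k" shows "dLambda k (Suc l) * W1 l i = W1 l i"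
proof -
  have l: "Suc l \<le> k" using assms by simp
  have "dLambda k (Suc l) * W1 l i
      = lam k T \<cdot>\<^sub>m ((dLambda k (Suc l) * sys Mp) * (ampl k (Suc l) sigma_plus * W l i))"
    using l by (simp add: W1_def mat_mult_smult mat_assoc)
  also have "dLambda k (Suc l) * sys Mp = sys Mp * dLambda k (Suc l)"
    unfolding dLambda_ampl using l by (intro ampl_commute) auto
  also have "(sys Mp * dLambda k (Suc l)) * (ampl k (Suc l) sigma_plus * W l i)
      = sys Mp * ((dLambda k (Suc l) * ampl k (Suc l) sigma_plus) * W l i)"
    using l by (simp add: mat_assoc)
  also have "dLambda k (Suc l) * ampl k (Suc l) sigma_plus = ampl k (Suc l) sigma_plus"
    unfolding dLambda_ampl using l by (subst ampl_mult[symmetric]) (auto simp: sigma_plus_minus_plus)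
  finally show ?thesis by (simp add: W1_def)
qed

lemma dLambda_W0:
  assumes "l < k" shows "dLambda k (Suc l) * W0 l i = 0\<^sub>m N 2"
proof -
  have l: "Suc l \<le> k" using assms by simp
  have "dLambda k (Suc l) * W0 l i = (dLambda k (Suc l) * sys No) * W l i"
    using l by (simp add: W0_def mat_assoc)
  also have "dLambda k (Suc l) * sys No = sys No * dLambda k (Suc l)"
    unfolding dLambda_ampl using l by (intro ampl_commute) auto
  also have "(sys No * dLambda k (Suc l)) * W l i = sys No * (dLambda k (Suc l) * W l i)"
    using l by (simp add: mat_assoc)
  finally show ?thesis using assms by (simp add: dLambda_W)
qed

text \<open>The new interaction commutes with the projection onto the earlier record. Afterwards
  \<open>W1\<close> lies in the range and \<open>W0\<close> in the kernel of the new counting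
  projection, so the gate selects exactly one of them.\<close>

lemma W_Suc:
  assumes "l < k"
  shows "W (Suc l) i = (if site k (Suc l) i = 0 then W1 l i else W0 l i)"
proof -
  have l: "Suc l \<le> k" using assms by simp
  have "W (Suc l) i = gate (Suc l) i * ((F l i * M (Suc l)) * (U l * vac k))"
    using l gate_carrier[OF l, of i] by (simp add: W_def F_Suc[OF l] mat_assoc del: gate_carrier)
  also have "F l i * M (Suc l) = M (Suc l) * F l i" using l by (simp add: M_commute_F)
  also have "(M (Suc l) * F l i) * (U l * vac k) = M (Suc l) * W l i"
    using l by (simp add: W_def mat_assoc)
  also have "\<dots> = W1 l i + W0 l i" using assms by (rule M_W)
  also have "gate (Suc l) i * (W1 l i + W0 l i) = (if site k (Suc l) i = 0 then W1 l i else W0 l i)"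
  proof -
    have "W1 l i - W1 l i + (W0 l i - 0\<^sub>m N 2) = W0 l i"
      by (rule eq_matI) auto
    moreover have "W1 l i + 0\<^sub>m N 2 = W1 l i" by (rule eq_matI) auto
    ultimately show ?thesis
      using l by (simp add: gate_def mat_mult_add mat_minus_mult dLambda_W1 dLambda_W0)
  qed
  finally show ?thesis .
qed

end

section \<open>Monotonicity of generated algebras, and the filtering equation as a scalar
  identity\<close>

lemma star_algebra_mono:
  assumes "S \<subseteq> S'" shows "star_algebra n S \<subseteq> star_algebra n S'"
proof
  fix A assume "A \<in> star_algebra n S"
  then show "A \<in> star_algebra n S'"
    by induction (use assms in \<open>auto intro: star_algebra.intros\<close>)
qed

lemma sigma_anticommutator: "sigma_minus * sigma_plus + sigma_plus * sigma_minus = 1\<^sub>m 2"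
  unfolding sigma_plus_minus
  by (rule eq_matI) (auto simp: sigma_minus_mat sigma_plus_mat scalar_prod_def numeral_2_eq_2 less_Suc_eq)

text \<open>The filtering equation at one record. Here m is the unnormalised mass before the step, a
  and b are its parts with and without a count, and mX, aX, bX are the corresponding numerators for
  X. The values q, r are arbitrary versions of the two quotients, d is the detector outcome and z
  the updated filter.\<close>

lemma filter_identity:
  fixes m mX mL a b c j aX bX w q r d z :: complex
  assumes m: "m \<noteq> 0" "a + b = m" "a = w * c" "aX = w * j" and X: "mX + w * mL = aX + bX"
    and null: "a = 0 \<Longrightarrow> aX = 0" "b = 0 \<Longrightarrow> bX = 0"
    and q: "c / m \<noteq> 0 \<Longrightarrow> q = j / m / (c / m)"
    and r: "1 - w * (c / m) \<noteq> 0 \<Longrightarrow> r = 1 / (1 - w * (c / m))"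
    and z: "d = 1 \<and> a \<noteq> 0 \<and> z = aX / a \<or> d = 0 \<and> b \<noteq> 0 \<and> z = bX / b"
  shows "z - mX / m = mL / m * w + r * (q - (mX + w * mL) / m) * (d - c / m * w)"
proof -
  \<comment> \<open>The expression to be inverted is the conditional probability of no
    count.\<close>
  have b: "1 - w * (c / m) = b / m" using m by (simp add: field_simps)
  have r': "r = m / b" if "b \<noteq> 0" using r that m unfolding b by simp
  have q': "q = aX / a" if "a \<noteq> 0" using q that m by simp
  have w: "mL * w = aX + bX - mX" using X by (simp add: algebra_simps)
  have cm: "c / m * w = a / m" using m by simp
  \<comment> \<open>The drift is the updated filter averaged over both outcomes, minus the old
    filter.\<close>
  have e: "mL / m * w = (aX + bX) / m - mX / m" using w by (simp add: diff_divide_distrib)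
  from z show ?thesis
  proof
    assume d: "d = 1 \<and> a \<noteq> 0 \<and> z = aX / a"
    then have qq: "q = aX / a" using q' by simp
    show ?thesis
    proof (cases "b = 0")
      case True
      then have am: "a = m" and bX: "bX = 0" using m(2) null by simp_all
      \<comment> \<open>A count that was certain carries no innovation, so the arbitrary value of r
        is multiplied by zero.\<close>
      have d0: "d - c / m * w = 0" unfolding cm am using d m(1) by simp
      show ?thesis unfolding e d0 bX using d am by simp
    next
      case False
      have "d - c / m * w = b / m" using d cm m by (simp add: field_simps)
      then have "r * (q - (mX + w * mL) / m) * (d - c / m * w) = q - (aX + bX) / m"
        using r' False m X by simp
      then show ?thesis using d qq e by simp
    qed
  next
    assume d: "d = 0 \<and> b \<noteq> 0 \<and> z = bX / b"
    show ?thesis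
    proof (cases "a = 0")
      case True
      then have bm: "b = m" and aX: "aX = 0" using m(2) null by simp_all
      \<comment> \<open>Likewise, if no count was possible and none occurred, the innovation
        vanishes and q does not matter.\<close>
      have d0: "d - c / m * w = 0" unfolding cm using d True by simp
      show ?thesis unfolding e d0 aX using d bm by simp
    next
      case False
      then have qq: "q = aX / a" using q' by simp
      have "r * (q - (mX + w * mL) / m) * (d - c / m * w) = - (m / b) * (aX / a - (aX + bX) / m) * (a / m)"
        unfolding cm X qq using r' d by simp
      also have "\<dots> = bX / b - (aX + bX) / m"
        using d m False unfolding m(2)[symmetric] by (simp add: divide_simps) (simp add: algebra_simps)
      finally show ?thesis using d e by simp
    qed
  qed
qed

section \<open>The recursion for the unnormalised conditional expectation\<close>

context repeated_interaction
begin

text \<open>Moving the field operators together leaves \<open>sigma_minus * sigma_plus\<close> on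
  the fresh factor. It acts there as the identity, because it adds up with
  \<open>sigma_plus * sigma_minus\<close> to 1 and the latter kills \<open>W l i\<close>.\<close>

lemma W1_gram:
  assumes "l < k" "X \<in> mat2"
  shows "mat_adjoint (W1 l i) * (sys X * W1 l i)
    = w \<cdot>\<^sub>m (mat_adjoint (W l i) * (sys (mat_adjoint Mp * X * Mp) * W l i))"
proof -
  let ?s = "ampl k (Suc l)" and ?V = "W l i" and ?Z = "mat_adjoint Mp * X * Mp"
  have l: "Suc l \<le> k" using assms by simp
  have Z: "sys ?Z = sys (mat_adjoint Mp) * (sys X * sys Mp)"
    using assms(2) carrier_matD[OF assms(2)] by (simp add: ampl_mult mat_assoc)
  have sig: "mat_adjoint (?s sigma_plus) = ?s sigma_minus"
    by (simp add: ampl_adjoint sigma_plus_def)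
  have "mat_adjoint (W1 l i) * (sys X * W1 l i)
      = w \<cdot>\<^sub>m (mat_adjoint ?V * ((?s sigma_minus * sys ?Z) * (?s sigma_plus * ?V)))"
    using assms l unfolding Z
    by (simp add: W1_def mat_adjoint_smult mat_adjoint_mult ampl_adjoint sig
        mat_smult_mult mat_mult_smult mat_smult_smult mat_assoc power2_eq_square del: ampl_adjoint)
      (simp add: ampl_adjoint)
  also have "?s sigma_minus * sys ?Z = sys ?Z * ?s sigma_minus"
    using assms by (intro ampl_commute) auto
  also have "(sys ?Z * ?s sigma_minus) * (?s sigma_plus * ?V) = sys ?Z * (?s (sigma_minus * sigma_plus) * ?V)"
    using l assms by (simp add: ampl_mult mat_assoc)
  also have "?s (sigma_minus * sigma_plus) * ?V = ?V"
  proof -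
    have "?s (sigma_minus * sigma_plus) * ?V
        = ?s (sigma_minus * sigma_plus) * ?V + ?s (sigma_plus * sigma_minus) * ?V"
      using dLambda_W[OF assms(1), of i] l unfolding dLambda_ampl by simp
    also have "\<dots> = (?s (sigma_minus * sigma_plus) + ?s (sigma_plus * sigma_minus)) * ?V"
      using l by (simp add: mat_add_mult)
    also have "\<dots> = ?s (1\<^sub>m 2) * ?V"
      using l by (subst ampl_add[symmetric]) (auto simp: sigma_anticommutator)
    finally show ?thesis using l by simp
  qed
  finally show ?thesis .
qed

lemma W0_gram:
  assumes "X \<in> mat2"
  shows "mat_adjoint (W0 l i) * (sys X * W0 l i)
    = mat_adjoint (W l i) * (sys (mat_adjoint No * X * No) * W l i)"
  using assms carrier_matD[OF assms] by (simp add: W0_def mat_adjoint_mult ampl_adjoint ampl_mult mat_assoc)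

definition mu :: "nat \<Rightarrow> nat \<Rightarrow> complex mat \<Rightarrow> complex" where
  "mu l i X = \<rho> (mat_adjoint (W l i) * (sys X * W l i))"

lemma mu_add:
  assumes "X \<in> mat2" "Y \<in> mat2"
  shows "mu l i (X + Y) = mu l i X + mu l i Y"
  using assms by (simp add: mu_def ampl_add mat_add_mult mat_mult_add state_add[OF state])

lemma mu_smult:
  assumes "X \<in> mat2" shows "mu l i (c \<cdot>\<^sub>m X) = c * mu l i X"
  using assms by (simp add: mu_def ampl_smult mat_smult_mult mat_mult_smult state_smult[OF state])

lemma mu_Suc:
  assumes "l < k" "X \<in> mat2"
  shows "mu (Suc l) i X = (if site k (Suc l) i = 0 then w * mu l i (mat_adjoint Mp * X * Mp)
     else mu l i (mat_adjoint No * X * No))"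
  using assms by (simp add: mu_def W_Suc W1_gram W0_gram state_smult[OF state])

text \<open>Conservation of mass: the interaction is isometric, and the two outcome branches are
  orthogonal because they lie in the eigenspaces 1 and 0 of the counting projection.\<close>

lemma mu_total:
  assumes "l < k"
  shows "w * mu l i (mat_adjoint Mp * Mp) + mu l i (mat_adjoint No * No) = mu l i (1\<^sub>m 2)"
proof -
  let ?V = "W l i" and ?A = "W1 l i" and ?B = "W0 l i"
  have l: "Suc l \<le> k" using assms by simp
  have cross: "mat_adjoint ?A * ?B = 0\<^sub>m 2 2"
  proof -
    have "mat_adjoint (dLambda k (Suc l)) = dLambda k (Suc l)"
      using l by (simp add: dLambda_dg dg_adjoint if_distrib cong: if_cong)
    then have "mat_adjoint ?A * ?B = mat_adjoint ?A * (dLambda k (Suc l) * ?B)"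
      using l dLambda_W1[OF assms, of i]
      by (metis M_dim(1) W1_W0_dim(1,3) dLambda_N(2,3) dim_mat_adjoint(2) mat_adjoint_mult mat_assoc)
    then show ?thesis by (simp add: dLambda_W0[OF assms])
  qed
  have cross': "mat_adjoint ?B * ?A = 0\<^sub>m 2 2"
  proof -
    have "mat_adjoint (mat_adjoint ?A * ?B) = mat_adjoint ?B * ?A"
      by (simp add: mat_adjoint_mult)
    moreover have "mat_adjoint (0\<^sub>m 2 2 :: complex mat) = 0\<^sub>m 2 2"
      by (rule eq_matI) auto
    ultimately show ?thesis unfolding cross by simp
  qed
  have "mat_adjoint ?V * ?V = mat_adjoint ?V * ((mat_adjoint (M (Suc l)) * M (Suc l)) * ?V)"
    using l M_unitary[of "Suc l"] by (simp add: N_def)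
  also have "\<dots> = mat_adjoint (M (Suc l) * ?V) * (M (Suc l) * ?V)"
    using l by (simp add: mat_adjoint_mult mat_assoc)
  also have "\<dots> = mat_adjoint ?A * ?A + mat_adjoint ?B * ?B"
    unfolding M_W[OF assms] by (subst mat_add_cross[where n = N and m = 2 and p = 2]) (auto simp: cross cross')
  finally have "\<rho> (mat_adjoint ?V * ?V) = \<rho> (mat_adjoint ?A * ?A) + \<rho> (mat_adjoint ?B * ?B)"
    by (simp add: state_add[OF state])
  moreover have "mat_adjoint ?A * ?A = mat_adjoint ?A * (sys (1\<^sub>m 2) * ?A)"
    "mat_adjoint ?B * ?B = mat_adjoint ?B * (sys (1\<^sub>m 2) * ?B)" by simp_all
  ultimately show ?thesis
    by (simp only: W1_gram[OF assms one_carrier_mat] W0_gram[OF one_carrier_mat] mu_def)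
      (simp add: state_smult[OF state])
qed

text \<open>Put V = \<open>sys Z * W l i\<close>. The hypothesis says that the Gram matrix of V has
  value 0 under \<open>\<rho>\<close>, and the claim pairs V with \<open>sys X * V\<close>.\<close>

lemma mu_null:
  assumes "X \<in> mat2" "Z \<in> mat2" "l \<le> k" "mu l i (mat_adjoint Z * Z) = 0"
  shows "mu l i (mat_adjoint Z * X * Z) = 0"
proof -
  have *: "mat_adjoint (W l i) * (sys (mat_adjoint Z * X * Z) * W l i)
     = mat_adjoint (sys Z * W l i) * (sys X * (sys Z * W l i))" if "X \<in> mat2" for X
    using assms(2) that carrier_matD[OF assms(2)] carrier_matD[OF that]
    by (simp add: mat_adjoint_mult ampl_adjoint ampl_mult mat_assoc)
  have "mat_adjoint (W l i) * (sys (mat_adjoint Z * Z) * W l i)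
     = mat_adjoint (sys Z * W l i) * (sys Z * W l i)"
    using assms(2) carrier_matD[OF assms(2)] by (simp add: mat_adjoint_mult ampl_adjoint ampl_mult mat_assoc)
  then have "\<rho> (mat_adjoint (sys Z * W l i) * (sys Z * W l i)) = 0"
    using assms(4) by (simp add: mu_def)
  from state_null_left[OF state _ _ this, of N] show ?thesis
    using assms unfolding mu_def *[OF assms(1)] by simp
qed

subsection \<open>The observation algebra as an algebra of functions\<close>

text \<open>One representation with the final unitary serves all times, so that filters at different
  times can be combined pointwise.\<close>

definition Psi :: "(nat \<Rightarrow> complex) \<Rightarrow> complex mat" where
  "Psi f = mat_adjoint (U k) * (dg N f * U k)"

lemma Psi_carrier [simp]: "Psi f \<in> carrier_mat N N"
  and Psi_dim [simp]: "dim_row (Psi f) = N" "dim_col (Psi f) = N"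
  by (simp_all add: Psi_def)

lemma Psi_mult: "Psi f * Psi g = Psi (\<lambda>r. f r * g r)"
proof -
  have "Psi f * Psi g = mat_adjoint (U k) * (dg N f * ((U k * mat_adjoint (U k)) * (dg N g * U k)))"
    by (simp add: Psi_def mat_assoc)
  also have "\<dots> = mat_adjoint (U k) * ((dg N f * dg N g) * U k)"
    by (simp add: U_unitary mat_assoc)
  finally show ?thesis by (simp add: dg_mult Psi_def)
qed

lemma Psi_add: "Psi f + Psi g = Psi (\<lambda>r. f r + g r)"
  by (simp add: Psi_def dg_add[symmetric] mat_add_mult mat_mult_add)

lemma Psi_minus: "Psi f - Psi g = Psi (\<lambda>r. f r - g r)"
  by (simp add: Psi_def dg_minus[symmetric] mat_minus_mult mat_mult_minus)

lemma Psi_smult: "c \<cdot>\<^sub>m Psi f = Psi (\<lambda>r. c * f r)"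
  by (simp add: Psi_def dg_smult[symmetric] mat_smult_mult mat_mult_smult)

lemma Psi_one: "1\<^sub>m N = Psi (\<lambda>r. 1)"
  by (simp add: Psi_def dg_one[symmetric] U_unitary)

lemma Psi_adjoint: "mat_adjoint (Psi f) = Psi (\<lambda>r. cnj (f r))"
  by (simp add: Psi_def mat_adjoint_mult dg_adjoint mat_assoc)

definition chi :: "nat \<Rightarrow> complex mat \<Rightarrow> complex" where
  "chi i A = (U k * A * mat_adjoint (U k)) $$ (i, i)"

lemma chi_Psi:
  assumes "i < N" shows "chi i (Psi f) = f i"
proof -
  have "U k * Psi f * mat_adjoint (U k) = (U k * mat_adjoint (U k)) * (dg N f * (U k * mat_adjoint (U k)))"
    by (simp add: Psi_def mat_assoc)
  then show ?thesis using assms by (simp add: chi_def U_unitary index_dg)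
qed

abbreviation "Y \<equiv> obs_algebra k T L1 L2 L3"

lemma dY_Psi:
  assumes "m \<in> {1..k}"
  shows "dY k T L1 L2 L3 m = Psi (\<lambda>r. if site k m r = 0 then 1 else 0)"
proof -
  have "mat_adjoint (U k) * (dLambda k m * U k) = mat_adjoint (U m) * (dLambda k m * U m)"
  proof (rule conj_U_stable)
    fix j assume "m < j" "j \<le> k"
    then show "M j * dLambda k m = dLambda k m * M j"
      unfolding dLambda_ampl using assms by (intro M_commute) auto
  qed (use assms in auto)
  then show ?thesis
    using assms by (simp add: dY_def Psi_def dLambda_dg_N[symmetric] mat_assoc)
qed

text \<open>Dependence on the first \<open>l\<close> outcomes only holds for the generators and is
  preserved by every operation of the algebra; it plays the part of measurability.\<close>

lemma Y_Psi:
  assumes "A \<in> Y l" "l \<le> k"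
  shows "\<exists>f. A = Psi f \<and> (\<forall>i r. agree l i r \<longrightarrow> f r = f i)"
  using assms(1) unfolding obs_algebra_def
proof induction
  case one
  then show ?case using Psi_one by (auto simp: N_def)
next
  case (gen A)
  then obtain m where m: "m \<in> {1..l}" "A = dY k T L1 L2 L3 m" by auto
  then have "A = Psi (\<lambda>r. if site k m r = 0 then 1 else 0)" using assms(2) by (simp add: dY_Psi)
  then show ?case using m by (intro exI[of _ "\<lambda>r. if site k m r = 0 then 1 else 0"]) (auto simp: agree_def)
next
  case (add A B)
  then obtain f g where "A = Psi f" "B = Psi g" "\<forall>i r. agree l i r \<longrightarrow> f r = f i"
    "\<forall>i r. agree l i r \<longrightarrow> g r = g i" by blast
  then show ?case by (intro exI[of _ "\<lambda>r. f r + g r"]) (auto simp: Psi_add)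
next
  case (smult A c)
  then obtain f where "A = Psi f" "\<forall>i r. agree l i r \<longrightarrow> f r = f i" by blast
  then show ?case by (intro exI[of _ "\<lambda>r. c * f r"]) (auto simp: Psi_smult)
next
  case (mult A B)
  then obtain f g where "A = Psi f" "B = Psi g" "\<forall>i r. agree l i r \<longrightarrow> f r = f i"
    "\<forall>i r. agree l i r \<longrightarrow> g r = g i" by blast
  then show ?case by (intro exI[of _ "\<lambda>r. f r * g r"]) (auto simp: Psi_mult)
next
  case (adjoint A)
  then obtain f where "A = Psi f" "\<forall>i r. agree l i r \<longrightarrow> f r = f i" by blast
  then show ?case by (intro exI[of _ "\<lambda>r. cnj (f r)"]) (auto simp: Psi_adjoint)
qed

text \<open>The indicator of a partial record is a product of factors \<open>dY\<close> or 1 -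
  \<open>dY\<close>, one for each site. These atoms are the test elements for conditional
  expectations.\<close>

lemma ind_in_Y:
  assumes "l \<le> k" shows "Psi (ind l i) \<in> Y l"
  using assms
proof (induction l)
  case 0
  have "Psi (ind 0 i) = 1\<^sub>m (qdim k)"
    using Psi_one by (simp add: ind_def[abs_def] agree_def N_def)
  then show ?case by (simp only: obs_algebra_def star_algebra.one)
next
  case (Suc l)
  let ?d = "\<lambda>r. if site k (Suc l) r = 0 then 1 else 0 :: complex"
  have "Y l \<subseteq> Y (Suc l)"
    unfolding obs_algebra_def by (intro star_algebra_mono image_mono) auto
  then have e: "Psi (ind l i) \<in> Y (Suc l)" using Suc by auto
  have d: "Psi ?d \<in> Y (Suc l)"
    using Suc.prems dY_Psi[of "Suc l"] unfolding obs_algebra_def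
    by (metis atLeastAtMost_iff image_eqI le_add1 le_refl plus_1_eq_Suc star_algebra.gen)
  have "1\<^sub>m (qdim k) + (-1) \<cdot>\<^sub>m Psi ?d \<in> Y (Suc l)"
    using d unfolding obs_algebra_def by (intro star_algebra.add star_algebra.smult star_algebra.one)
  then have d': "Psi (\<lambda>r. 1 - ?d r) \<in> Y (Suc l)"
    unfolding N_def[symmetric] by (simp add: Psi_one Psi_smult Psi_add)
  have "(if site k (Suc l) i = 0 then Psi ?d else Psi (\<lambda>r. 1 - ?d r)) * Psi (ind l i) \<in> Y (Suc l)"
    using e d d' unfolding obs_algebra_def by (intro star_algebra.mult) auto
  moreover have "(if site k (Suc l) i = 0 then Psi ?d else Psi (\<lambda>r. 1 - ?d r)) * Psi (ind l i)
      = Psi (ind (Suc l) i)"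
    unfolding ind_Suc by (simp add: Psi_mult)
  ultimately show ?case by simp
qed

text \<open>On the range of \<open>Psi\<close>, \<open>chi i\<close> is evaluation at
  \<open>i\<close>. This connects quotients, which are specified through characters, with values at
  basis indices.\<close>

lemma chi_character:
  assumes "i < N" shows "is_character (qdim k) (Y k) (chi i)"
proof -
  have one: "chi i (1\<^sub>m (qdim k)) = 1"
    using chi_Psi[OF assms, of "\<lambda>_. 1"] by (simp add: Psi_one[symmetric] N_def)
  have rep: "\<exists>f. A = Psi f" if "A \<in> Y k" for A using Y_Psi[OF that] by blast
  show ?thesis
    unfolding is_character_def
  proof (intro conjI ballI allI)
    fix A B assume "A \<in> Y k" "B \<in> Y k"
    then obtain f g where "A = Psi f" "B = Psi g" using rep by blast
    then show "chi i (A + B) = chi i A + chi i B" "chi i (A * B) = chi i A * chi i B"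
      using assms by (simp_all add: Psi_add Psi_mult chi_Psi)
  next
    fix A c assume "A \<in> Y k"
    then obtain f where "A = Psi f" using rep by blast
    then show "chi i (c \<cdot>\<^sub>m A) = c * chi i A" using assms by (simp add: Psi_smult chi_Psi)
  next
    fix A assume "A \<in> Y k"
    then obtain f where "A = Psi f" using rep by blast
    then show "chi i (mat_adjoint A) = cnj (chi i A)" using assms by (simp add: Psi_adjoint chi_Psi)
  qed (rule one)
qed

section \<open>The distribution of outcomes and the conditional expectations\<close>

definition wt :: "nat \<Rightarrow> complex" where
  "wt = weight \<rho> (U k * vac k)"

lemma PP_N: "A \<in> carrier_mat N N \<Longrightarrow> PP \<rho> k A = \<rho> (mat_adjoint (vac k) * (A * vac k))"
  unfolding N_def by (rule PP_eq)

lemma PP_Psi: "PP \<rho> k (Psi f) = (\<Sum>r<N. f r * wt r)"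
proof -
  have "mat_adjoint (vac k) * (Psi f * vac k) = mat_adjoint (U k * vac k) * (dg N f * (U k * vac k))"
    by (simp add: Psi_def mat_adjoint_mult mat_assoc)
  then show ?thesis
    using state_diagonal_sum[OF state, of "U k * vac k" N f] by (simp add: PP_N wt_def weight_def)
qed

text \<open>Rotated back to time \<open>l\<close>, the indicator is \<open>F l i\<close>, which is
  idempotent and commutes with system operators. One copy of it can therefore be placed on each side
  of \<open>X\<close>, giving the two factors \<open>W l i\<close>.\<close>

lemma PP_flow_ind:
  assumes "l \<le> k" "X \<in> mat2"
  shows "PP \<rho> k (flow k T L1 L2 L3 l X * Psi (ind l i)) = mu l i X"
proof -
  have P: "Psi (ind l i) = mat_adjoint (U l) * (F l i * U l)"
    unfolding Psi_def using assms by (intro conj_U_stable) (auto intro: M_commute_F)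
  have FF: "F l i * F l i = F l i"
    by (simp add: dg_mult ind_def[abs_def] if_distrib cong: if_cong)
  have Fa: "mat_adjoint (F l i) = F l i"
    by (simp add: dg_adjoint ind_def[abs_def] if_distrib cong: if_cong)
  have "flow k T L1 L2 L3 l X * Psi (ind l i)
      = mat_adjoint (U l) * (sys X * ((U l * mat_adjoint (U l)) * (F l i * U l)))"
    unfolding P using assms by (simp add: flow_def mat_assoc)
  also have "\<dots> = mat_adjoint (U l) * ((sys X * F l i) * (F l i * U l))"
    using assms by (simp add: U_unitary mat_assoc) (simp add: FF mat_assoc[symmetric])
  also have "sys X * F l i = F l i * sys X"
    using assms by (intro ampl_commute_F) auto
  finally have e: "flow k T L1 L2 L3 l X * Psi (ind l i)
      = mat_adjoint (U l) * ((F l i * sys X) * (F l i * U l))" .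
  have "mat_adjoint (vac k) * (mat_adjoint (U l) * ((F l i * sys X) * (F l i * U l)) * vac k)
      = mat_adjoint (W l i) * (sys X * W l i)"
    using assms by (simp add: W_def mat_adjoint_mult Fa mat_assoc)
  then show ?thesis
    unfolding e mu_def using assms by (subst PP_N) auto
qed

lemma PP_ind:
  assumes "l \<le> k" shows "PP \<rho> k (Psi (ind l i)) = mu l i (1\<^sub>m 2)"
proof -
  have "flow k T L1 L2 L3 l (1\<^sub>m 2) = 1\<^sub>m N"
    using assms by (simp add: flow_def U_unitary)
  then show ?thesis using PP_flow_ind[OF assms, of "1\<^sub>m 2" i] by simp
qed

text \<open>The value is the total mass of all indices sharing the first \<open>l\<close> outcomes
  of \<open>i\<close>; the masses are nonnegative and \<open>i\<close> is among these
  indices.\<close>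

lemma mu_one_nonzero:
  assumes "l \<le> k" "i < N" "wt i \<noteq> 0"
  shows "mu l i (1\<^sub>m 2) \<noteq> 0"
proof
  assume "mu l i (1\<^sub>m 2) = 0"
  then have "(\<Sum>r<N. ind l i r * wt r) = 0" using PP_ind[OF assms(1), of i] by (simp add: PP_Psi)
  moreover have "0 \<le> ind l i r * wt r" for r
    using weight_nonneg[OF state] by (simp add: ind_def wt_def)
  ultimately have "ind l i i * wt i = 0"
    using assms(2) by (subst (asm) sum_nonneg_eq_0_iff) auto
  then show False using assms(3) by (simp add: ind_def agree_def)
qed

text \<open>Any version is constant on the atom of \<open>i\<close>, so testing it against the
  indicator of that atom fixes the constant as a ratio.\<close>

lemma cond_exp_Psi:
  assumes "l \<le> k" "X \<in> mat2" "is_cond_exp (PP \<rho> k) (Y l) (flow k T L1 L2 L3 l X) E"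
  obtains f where "E = Psi f" "\<And>i. i < N \<Longrightarrow> wt i \<noteq> 0 \<Longrightarrow> f i = mu l i X / mu l i (1\<^sub>m 2)"
proof -
  have "E \<in> Y l" using assms(3) by (simp add: is_cond_exp_def)
  then obtain f where f: "E = Psi f" "\<And>i r. agree l i r \<Longrightarrow> f r = f i"
    using Y_Psi assms(1) by blast
  have "f i = mu l i X / mu l i (1\<^sub>m 2)" if i: "i < N" "wt i \<noteq> 0" for i
  proof -
    have "(\<lambda>r. f r * ind l i r) = (\<lambda>r. f i * ind l i r)"
      by (auto simp: ind_def f(2))
    then have "E * Psi (ind l i) = f i \<cdot>\<^sub>m Psi (ind l i)"
      by (simp add: f(1) Psi_mult Psi_smult)
    then have "PP \<rho> k (E * Psi (ind l i)) = f i * PP \<rho> k (Psi (ind l i))"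
      by (simp add: Psi_smult PP_Psi sum_distrib_left mult.assoc)
    moreover have "PP \<rho> k (E * Psi (ind l i)) = mu l i X"
      using assms ind_in_Y[OF assms(1), of i] PP_flow_ind[OF assms(1,2), of i]
      by (simp add: is_cond_exp_def)
    ultimately show ?thesis
      using mu_one_nonzero[OF assms(1) i] by (simp add: PP_ind[OF assms(1)] field_simps)
  qed
  then show ?thesis using f(1) that by blast
qed

section \<open>Almost sure equality, quotients, and the filtering equation\<close>

lemma eq_as_Psi:
  assumes "\<And>i. i < N \<Longrightarrow> wt i \<noteq> 0 \<Longrightarrow> f i = g i"
  shows "eq_as (PP \<rho> k) (Psi f) (Psi g)"
  unfolding eq_as_def Psi_minus Psi_adjoint Psi_mult PP_Psi
  using assms by (intro sum.neutral) force

lemma quotient_Psi: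
  assumes "is_quotient (qdim k) (Y k) (Psi f) (Psi g) Q"
  obtains q where "Q = Psi q" "\<And>i. i < N \<Longrightarrow> g i \<noteq> 0 \<Longrightarrow> q i = f i / g i"
proof -
  have "Q \<in> Y k" using assms by (simp add: is_quotient_def)
  then obtain q where q: "Q = Psi q" using Y_Psi by blast
  have "q i = f i / g i" if "i < N" "g i \<noteq> 0" for i
    using assms chi_character[OF that(1)] that unfolding is_quotient_def q
    by (metis chi_Psi)
  then show ?thesis using q that by blast
qed

text \<open>Explains the formula for the generator: adding w times it to \<open>X\<close> gives the
  one-step evolution averaged over the outcomes, a count through \<open>Mp\<close> or no count
  through \<open>No\<close>.\<close>

lemma generator_decompose:
  assumes "X \<in> mat2"
  shows "X + w \<cdot>\<^sub>m generator (lam k T) Mp Mo X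
    = w \<cdot>\<^sub>m (mat_adjoint Mp * X * Mp) + mat_adjoint No * X * No"
proof -
  have "mat_adjoint No = 1\<^sub>m 2 + w \<cdot>\<^sub>m mat_adjoint Mo"
    by (simp add: No_def mat_adjoint_add[where n = 2 and m = 2] mat_adjoint_smult)
  then have "mat_adjoint No * X * No
      = (X + w \<cdot>\<^sub>m (mat_adjoint Mo * X)) + (w \<cdot>\<^sub>m (X * Mo) + w \<cdot>\<^sub>m (w \<cdot>\<^sub>m (mat_adjoint Mo * X * Mo)))"
    using assms carrier_matD[OF assms] by (simp add: No_def mat_add_mult mat_mult_add mat_smult_mult mat_mult_smult
        add_smult_distrib_left_mat[where nr = 2 and nc = 2])
  then show ?thesis
    using assms carrier_matD[OF assms] by (simp only: generator_def) (intro eq_matI, auto simp: algebra_simps simp del: index_mult_mat(1))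
qed

lemma filter_step:
  assumes cond: "\<And>l X. l \<le> k \<Longrightarrow> X \<in> mat2 \<Longrightarrow>
      is_cond_exp (PP \<rho> k) (Y l) (flow k T L1 L2 L3 l X) (\<pi> l X)"
    and X: "X \<in> mat2" and l: "l < k"
    and R: "is_quotient (qdim k) (Y k) (1\<^sub>m (qdim k))
      (1\<^sub>m (qdim k) - w \<cdot>\<^sub>m \<pi> l (mat_adjoint Mp * Mp)) R"
    and Q: "is_quotient (qdim k) (Y k) (\<pi> l (mat_adjoint Mp * X * Mp)) (\<pi> l (mat_adjoint Mp * Mp)) Q"
  shows "eq_as (PP \<rho> k) (\<pi> (Suc l) X - \<pi> l X)
      (\<pi> l (generator (lam k T) Mp Mo X) * dt k T (Suc l)
       + R * (Q - \<pi> l (X + w \<cdot>\<^sub>m generator (lam k T) Mp Mo X))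
           * (dY k T L1 L2 L3 (Suc l) - \<pi> l (mat_adjoint Mp * Mp) * dt k T (Suc l)))"
proof -
  let ?L = "generator (lam k T) Mp Mo X"
  let ?J = "mat_adjoint Mp * X * Mp" and ?N = "mat_adjoint No * X * No"
  have L: "?L \<in> mat2" using X carrier_matD[OF X] by (simp add: generator_def)
  have XL: "X + w \<cdot>\<^sub>m ?L \<in> mat2" using X L by simp
  have mem: "?J \<in> mat2" "?N \<in> mat2" "mat_adjoint Mp * Mp \<in> mat2" using X carrier_matD[OF X] by simp_all
  have l': "l \<le> k" "Suc l \<le> k" using l by auto
  obtain f1 where f1: "\<pi> (Suc l) X = Psi f1"
    "\<And>i. i < N \<Longrightarrow> wt i \<noteq> 0 \<Longrightarrow> f1 i = mu (Suc l) i X / mu (Suc l) i (1\<^sub>m 2)"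
    using cond_exp_Psi[OF l'(2) X cond[OF l'(2) X]] by blast
  obtain f2 where f2: "\<pi> l X = Psi f2"
    "\<And>i. i < N \<Longrightarrow> wt i \<noteq> 0 \<Longrightarrow> f2 i = mu l i X / mu l i (1\<^sub>m 2)"
    using cond_exp_Psi[OF l'(1) X cond[OF l'(1) X]] by blast
  obtain f3 where f3: "\<pi> l ?L = Psi f3"
    "\<And>i. i < N \<Longrightarrow> wt i \<noteq> 0 \<Longrightarrow> f3 i = mu l i ?L / mu l i (1\<^sub>m 2)"
    using cond_exp_Psi[OF l'(1) L cond[OF l'(1) L]] by blast
  obtain f4 where f4: "\<pi> l (X + w \<cdot>\<^sub>m ?L) = Psi f4"
    "\<And>i. i < N \<Longrightarrow> wt i \<noteq> 0 \<Longrightarrow> f4 i = mu l i (X + w \<cdot>\<^sub>m ?L) / mu l i (1\<^sub>m 2)"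
    using cond_exp_Psi[OF l'(1) XL cond[OF l'(1) XL]] by blast
  obtain f5 where f5: "\<pi> l (mat_adjoint Mp * Mp) = Psi f5"
    "\<And>i. i < N \<Longrightarrow> wt i \<noteq> 0 \<Longrightarrow> f5 i = mu l i (mat_adjoint Mp * Mp) / mu l i (1\<^sub>m 2)"
    using cond_exp_Psi[OF l'(1) mem(3) cond[OF l'(1) mem(3)]] by blast
  obtain f6 where f6: "\<pi> l ?J = Psi f6"
    "\<And>i. i < N \<Longrightarrow> wt i \<noteq> 0 \<Longrightarrow> f6 i = mu l i ?J / mu l i (1\<^sub>m 2)"
    using cond_exp_Psi[OF l'(1) mem(1) cond[OF l'(1) mem(1)]] by blast
  have "is_quotient (qdim k) (Y k) (Psi (\<lambda>_. 1)) (Psi (\<lambda>r. 1 - w * f5 r)) R"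
    using R unfolding f5(1) N_def[symmetric] by (simp add: Psi_one Psi_smult Psi_minus)
  then obtain r where r: "R = Psi r"
    "\<And>i. i < N \<Longrightarrow> 1 - w * f5 i \<noteq> 0 \<Longrightarrow> r i = 1 / (1 - w * f5 i)"
    using quotient_Psi by blast
  obtain q where q: "Q = Psi q" "\<And>i. i < N \<Longrightarrow> f5 i \<noteq> 0 \<Longrightarrow> q i = f6 i / f5 i"
    using quotient_Psi[OF Q[unfolded f5(1) f6(1)]] by blast
  define d :: "nat \<Rightarrow> complex" where "d r = (if site k (Suc l) r = 0 then 1 else 0)" for r
  have dY: "dY k T L1 L2 L3 (Suc l) = Psi d"
    using l dY_Psi[of "Suc l"] by (simp add: d_def[abs_def])
  have dt: "dt k T (Suc l) = Psi (\<lambda>r. w)"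
    by (simp add: dt_N Psi_one Psi_smult)
  have main: "f1 i - f2 i = f3 i * w + r i * (q i - f4 i) * (d i - f5 i * w)"
    if i: "i < N" "wt i \<noteq> 0" for i
  proof -
    let ?m = "mu l i (1\<^sub>m 2)"
    have m: "?m \<noteq> 0" "mu (Suc l) i (1\<^sub>m 2) \<noteq> 0" using mu_one_nonzero l' i by blast+
    have split: "mu l i X + w * mu l i ?L = w * mu l i ?J + mu l i ?N"
      using arg_cong[OF generator_decompose[OF X], of "mu l i"] X L mem
      by (simp only: mu_add mu_smult smult_carrier_mat)
    have f4': "f4 i = (mu l i X + w * mu l i ?L) / ?m"
      using f4(2)[OF i] X L by (simp add: mu_add mu_smult)
    have one: "mat_adjoint Mp * 1\<^sub>m 2 * Mp = mat_adjoint Mp * Mp" "mat_adjoint No * 1\<^sub>m 2 * No = mat_adjoint No * No"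
      by simp_all
    \<comment> \<open>The mass \<open>mu l i (1\<^sub>m 2)\<close> splits into a count part and a
      no-count part; each conditional expectation has been replaced by its ratio at
      \<open>i\<close>.\<close>
    show ?thesis
      unfolding f1(2)[OF i] f2(2)[OF i] f3(2)[OF i] f4' f5(2)[OF i]
    proof (rule filter_identity[where j = "mu l i ?J" and a = "w * mu l i (mat_adjoint Mp * Mp)"
          and b = "mu l i (mat_adjoint No * No)" and aX = "w * mu l i ?J" and bX = "mu l i ?N"])
      show "w * mu l i (mat_adjoint Mp * Mp) = 0 \<Longrightarrow> w * mu l i ?J = 0"
        using mu_null[OF X _ l'(1), of Mp i] by auto
      show "mu l i (mat_adjoint No * No) = 0 \<Longrightarrow> mu l i ?N = 0"
        using mu_null[OF X _ l'(1), of No i] by auto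
      show "mu l i (mat_adjoint Mp * Mp) / ?m \<noteq> 0 \<Longrightarrow>
          q i = mu l i ?J / ?m / (mu l i (mat_adjoint Mp * Mp) / ?m)"
        using q(2)[OF i(1)] unfolding f5(2)[OF i] f6(2)[OF i] by simp
      show "1 - w * (mu l i (mat_adjoint Mp * Mp) / ?m) \<noteq> 0 \<Longrightarrow>
          r i = 1 / (1 - w * (mu l i (mat_adjoint Mp * Mp) / ?m))"
        using r(2)[OF i(1)] unfolding f5(2)[OF i] .
      \<comment> \<open>The mass after the step is nonzero at \<open>i\<close>, so the outcome that
        \<open>i\<close> prescribes at site \<open>Suc l\<close> has nonzero mass, and its quotient
        is the updated filter.\<close>
      show "d i = 1 \<and> w * mu l i (mat_adjoint Mp * Mp) \<noteq> 0 \<and>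
          mu (Suc l) i X / mu (Suc l) i (1\<^sub>m 2) = w * mu l i ?J / (w * mu l i (mat_adjoint Mp * Mp)) \<or>
        d i = 0 \<and> mu l i (mat_adjoint No * No) \<noteq> 0 \<and>
          mu (Suc l) i X / mu (Suc l) i (1\<^sub>m 2) = mu l i ?N / mu l i (mat_adjoint No * No)"
        using m(2) unfolding mu_Suc[OF l X] mu_Suc[OF l one_carrier_mat] one d_def
        by (cases "site k (Suc l) i = 0") auto
    qed (use m mu_total[OF l] split in simp_all)
  qed
  show ?thesis
    unfolding f1(1) f2(1) f3(1) f4(1) f5(1) r(1) q(1) dY dt
    by (simp only: Psi_minus Psi_mult Psi_add) (rule eq_as_Psi, rule main)
qed

end

theorem mainTheorem2:
  fixes k :: nat and T :: real
    and \<rho> :: "complex mat \<Rightarrow> complex"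
    and L1 L2 L3 Mpm Mp Mm Mo :: "complex mat"
    and \<pi> :: "nat \<Rightarrow> complex mat \<Rightarrow> complex mat"
  assumes "T > 0"
    and "is_state 2 \<rho>"
    and "L1 \<in> carrier_mat 2 2" and "L2 \<in> carrier_mat 2 2" and "L3 \<in> carrier_mat 2 2"
    and "mat_adjoint L1 = L1" and "mat_adjoint L3 = L3"
    and "Mpm \<in> carrier_mat 2 2" and "Mp \<in> carrier_mat 2 2"
    and "Mm \<in> carrier_mat 2 2" and "Mo \<in> carrier_mat 2 2"
    and "\<And>l. l \<in> {1..k} \<Longrightarrow>
           interaction k T L1 L2 L3 l - 1\<^sub>m (qdim k) =
             ampl k 0 Mpm * dLambda k l + ampl k 0 Mp * dAs k T l
             + ampl k 0 Mm * dA k T l + ampl k 0 Mo * dt k T l"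
    and "\<And>l X. l \<le> k \<Longrightarrow> X \<in> carrier_mat 2 2 \<Longrightarrow>
           is_cond_exp (PP \<rho> k) (obs_algebra k T L1 L2 L3 l) (flow k T L1 L2 L3 l X) (\<pi> l X)"
  shows "\<forall>X \<in> carrier_mat 2 2. \<forall>l \<in> {1..k}. \<forall>R Q.
    is_quotient (qdim k) (obs_algebra k T L1 L2 L3 k)
      (1\<^sub>m (qdim k)) (1\<^sub>m (qdim k) - (lam k T)\<^sup>2 \<cdot>\<^sub>m \<pi> (l - 1) (mat_adjoint Mp * Mp)) R \<longrightarrow>
    is_quotient (qdim k) (obs_algebra k T L1 L2 L3 k)
      (\<pi> (l - 1) (mat_adjoint Mp * X * Mp)) (\<pi> (l - 1) (mat_adjoint Mp * Mp)) Q \<longrightarrow>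
    eq_as (PP \<rho> k)
      (\<pi> l X - \<pi> (l - 1) X)
      (\<pi> (l - 1) (generator (lam k T) Mp Mo X) * dt k T l
       + R * (Q - \<pi> (l - 1) (X + (lam k T)\<^sup>2 \<cdot>\<^sub>m generator (lam k T) Mp Mo X))
           * (dY k T L1 L2 L3 l - \<pi> (l - 1) (mat_adjoint Mp * Mp) * dt k T l))"
proof (intro ballI allI impI)
  interpret repeated_interaction k T \<rho> L1 L2 L3 Mpm Mp Mm Mo
    using assms(2-12) by unfold_locales
  fix X l R Q
  assume X: "X \<in> mat2" and l: "l \<in> {1..k}"
    and R: "is_quotient (qdim k) (Y k) (1\<^sub>m (qdim k))
      (1\<^sub>m (qdim k) - w \<cdot>\<^sub>m \<pi> (l - 1) (mat_adjoint Mp * Mp)) R"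
    and Q: "is_quotient (qdim k) (Y k) (\<pi> (l - 1) (mat_adjoint Mp * X * Mp))
      (\<pi> (l - 1) (mat_adjoint Mp * Mp)) Q"
  have "l - 1 < k" "Suc (l - 1) = l" using l by auto
  then show "eq_as (PP \<rho> k)
      (\<pi> l X - \<pi> (l - 1) X)
      (\<pi> (l - 1) (generator (lam k T) Mp Mo X) * dt k T l
       + R * (Q - \<pi> (l - 1) (X + (lam k T)\<^sup>2 \<cdot>\<^sub>m generator (lam k T) Mp Mo X))
           * (dY k T L1 L2 L3 l - \<pi> (l - 1) (mat_adjoint Mp * Mp) * dt k T l))"
    using filter_step[of \<pi>, OF assms(13) X _ R Q] by metis
qed

end
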